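(* Let $m\ge1$ be an integer. Let $\omega$ be a modulus of continuity, not identically zero, and let $\Omega(x)=\int_0^x\omega(t/2)\,dt$ and, for $c>0$, $\gamma_c(x)=\Omega^{-1}(c\,\Omega(x))$. Suppose that for every $c>0$ the function $\gamma_c(x)/x$ is monotone in a right neighborhood of zero. Let the weight function $P:[0,1]\to\mathbb{R}$ be continuous and positive almost everywhere on $[0,1]$, and let $$B=B(P,\omega)=\lim_{n\to\infty}\sum_{k=1}^n\Omega^{-1}\Bigl(P\Bigl(\frac{2k-1}{2n}\Bigr)\Omega\Bigl(\frac1n\Bigr)\Bigr).$$ Then $$\limsup_{n\to\infty}\frac{R_n\bigl(H^\omega([0,1],K(\mathbb{R}^m))\bigr)}{n\,\Omega(B/n)}=1,$$ where $R_n$ is the optimal error of recovery, using $n$ free knots, of the weighted integral $\int_0^1P(x)f(x)\,dx$.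
   Context: $K(\mathbb{R}^m)$ is the set of nonempty compact subsets of $\mathbb{R}^m$, and $K^c(\mathbb{R}^m)$ is the set of its convex elements. For $A,B\in K(\mathbb{R}^m)$ and $\lambda,\mu\in\mathbb{R}$, $\lambda A+\mu B=\{\lambda a+\mu b:a\in A,\,b\in B\}$ (Minkowski combination). With $\|\cdot\|$ the Euclidean norm, $d(a,B)=\inf_{b\in B}\|a-b\|$ and $d(A,B)=\sup_{a\in A}d(a,B)$, the Hausdorff metric on $K(\mathbb{R}^m)$ is $\delta(A,B)=\max\{d(A,B),d(B,A)\}$. Riemann–Minkowski integral: for $g:[0,1]\to K(\mathbb{R}^m)$, a partition $0=t_0<t_1<\dots<t_N=1$ and tags $\xi_i\in[t_{i-1},t_i]$, the Riemann–Minkowski sum is $\sum_{i=1}^N(t_i-t_{i-1})g(\xi_i)$. The function $g$ is integrable, with integral $\int_0^1g(x)\,dx=I\in K(\mathbb{R}^m)$, if the Riemann–Minkowski sums converge to $I$ in the metric $\delta$ as the mesh $\max_i(t_i-t_{i-1})$ tends to $0$. Integrals of set-valued functions are understood in this sense; continuous bounded functions are integrable. A modulus of continuity is, as usual, a continuous nondecreasing subadditive function $\omega:[0,\infty)\to[0,\infty)$ with $\omega(0)=0$. $H^\omega([0,1],K(\mathbb{R}^m))$ is the class of functions $f:[0,1]\to K(\mathbb{R}^m)$ such that $\delta(f(x'),f(x''))\le\omega(|x'-x''|)$ for all $x',x''\in[0,1]$. For a set of knots $\overline{x}=\{x_1,\dots,x_n\}$, $0\le x_1<\dots<x_n\le1$,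 a method of recovery is an arbitrary mapping $\Phi:K(\mathbb{R}^m)^n\to K^c(\mathbb{R}^m)$. For a class $\mathcal{M}$ of integrable functions, $$R(\mathcal{M},\overline{x},\Phi)=\sup_{f\in\mathcal{M}}\delta\Bigl(\int_0^1P(x)f(x)\,dx,\ \Phi(f(x_1),\dots,f(x_n))\Bigr),\qquad R(\mathcal{M},\overline{x})=\inf_{\Phi}R(\mathcal{M},\overline{x},\Phi),$$ $$R_n(\mathcal{M})=\inf_{\#(\overline{x})=n}R(\mathcal{M},\overline{x}),$$ where $\#(\overline{x})$ is the number of elements of $\overline{x}$. *)

theory Defs
  imports "HOL-Analysis.Analysis"
begin

definition nonempty_compacts :: "'a::euclidean_space set set" where
  "nonempty_compacts = {A. compact A \<and> A \<noteq> {}}"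

definition nonempty_convex_compacts :: "'a::euclidean_space set set" where
  "nonempty_convex_compacts = {A \<in> nonempty_compacts. convex A}"

definition scale_set :: "real \<Rightarrow> 'a::real_vector set \<Rightarrow> 'a set" where
  "scale_set c A = (\<lambda>v. c *\<^sub>R v) ` A"

definition hausdorff_excess :: "'a::euclidean_space set \<Rightarrow> 'a set \<Rightarrow> real" where
  "hausdorff_excess A B = (SUP a\<in>A. infdist a B)"

text \<open>This is a metric on \<^const>\<open>nonempty_compacts\<close>; other arguments are never used.\<close>

definition hausdorff_dist :: "'a::euclidean_space set \<Rightarrow> 'a set \<Rightarrow> real" where
  "hausdorff_dist A B = max (hausdorff_excess A B) (hausdorff_excess B A)"

definition tagged_partition :: "nat \<Rightarrow> (nat \<Rightarrow> real) \<Rightarrow> (nat \<Rightarrow> real) \<Rightarrow> bool" where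
  "tagged_partition N t \<xi> \<longleftrightarrow> t 0 = 0 \<and> t N = 1 \<and>
     (\<forall>i\<in>{1..N}. t (i - 1) < t i \<and> \<xi> i \<in> {t (i - 1)..t i})"

definition mesh :: "nat \<Rightarrow> (nat \<Rightarrow> real) \<Rightarrow> real" where
  "mesh N t = Max ((\<lambda>i. t i - t (i - 1)) ` {1..N})"

text \<open>The sum of sets is the Minkowski sum from \<^theory>\<open>HOL-Library.Set_Algebras\<close>.\<close>

definition riemann_minkowski_sum ::
  "(real \<Rightarrow> 'a::euclidean_space set) \<Rightarrow> nat \<Rightarrow> (nat \<Rightarrow> real) \<Rightarrow> (nat \<Rightarrow> real) \<Rightarrow> 'a set" where
  "riemann_minkowski_sum g N t \<xi> = (\<Sum>i\<in>{1..N}. scale_set (t i - t (i - 1)) (g (\<xi> i)))"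

definition has_rm_integral :: "(real \<Rightarrow> 'a::euclidean_space set) \<Rightarrow> 'a set \<Rightarrow> bool" where
  "has_rm_integral g I \<longleftrightarrow>
     g \<in> {0..1} \<rightarrow> nonempty_compacts \<and> I \<in> nonempty_compacts \<and>
     (\<forall>\<epsilon>>0. \<exists>\<eta>>0. \<forall>N t \<xi>. tagged_partition N t \<xi> \<and> mesh N t < \<eta> \<longrightarrow>
        hausdorff_dist (riemann_minkowski_sum g N t \<xi>) I < \<epsilon>)"

definition rm_integral :: "(real \<Rightarrow> 'a::euclidean_space set) \<Rightarrow> 'a set" where
  "rm_integral g = (THE I. has_rm_integral g I)"

definition modulus_of_continuity :: "(real \<Rightarrow> real) \<Rightarrow> bool" where
  "modulus_of_continuity \<omega> \<longleftrightarrow>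
     \<omega> \<in> {0..} \<rightarrow> {0..} \<and> \<omega> 0 = 0 \<and> continuous_on {0..} \<omega> \<and> mono_on {0..} \<omega> \<and>
     (\<forall>s\<ge>0. \<forall>t\<ge>0. \<omega> (s + t) \<le> \<omega> s + \<omega> t)"

text \<open>Functions on \<open>[0,1]\<close> are total functions on \<^typ>\<open>real\<close>. Their values elsewhere are
  unconstrained, and nothing below depends on those values.\<close>

definition H_class :: "(real \<Rightarrow> real) \<Rightarrow> (real \<Rightarrow> 'a::euclidean_space set) set" where
  "H_class \<omega> = {f. f \<in> {0..1} \<rightarrow> nonempty_compacts \<and>
     (\<forall>x'\<in>{0..1}. \<forall>x''\<in>{0..1}. hausdorff_dist (f x') (f x'') \<le> \<omega> \<bar>x' - x''\<bar>)}"

text \<open>A set of \<open>n\<close> knots is given by its increasing enumeration, and an \<open>n\<close>-tuple of sets is a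
  list of length \<open>n\<close>.\<close>

definition knot_lists :: "nat \<Rightarrow> real list set" where
  "knot_lists n = {xs. length xs = n \<and> sorted_wrt (<) xs \<and> set xs \<subseteq> {0..1}}"

definition recovery_methods :: "nat \<Rightarrow> ('a::euclidean_space set list \<Rightarrow> 'a set) set" where
  "recovery_methods n =
     {\<Phi>. \<forall>As. length As = n \<and> set As \<subseteq> nonempty_compacts \<longrightarrow> \<Phi> As \<in> nonempty_convex_compacts}"

text \<open>The errors are extended reals: over an unbounded class the supremum can be infinite.\<close>

definition method_error :: "(real \<Rightarrow> real) \<Rightarrow> (real \<Rightarrow> 'a::euclidean_space set) set \<Rightarrow>
    real list \<Rightarrow> ('a set list \<Rightarrow> 'a set) \<Rightarrow> ereal" where
  "method_error P M xs \<Phi> =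
     (SUP f\<in>M. ereal (hausdorff_dist (rm_integral (\<lambda>x. scale_set (P x) (f x))) (\<Phi> (map f xs))))"

definition knots_error ::
  "(real \<Rightarrow> real) \<Rightarrow> (real \<Rightarrow> 'a::euclidean_space set) set \<Rightarrow> real list \<Rightarrow> ereal" where
  "knots_error P M xs = (INF \<Phi>\<in>recovery_methods (length xs). method_error P M xs \<Phi>)"

definition optimal_error ::
  "(real \<Rightarrow> real) \<Rightarrow> (real \<Rightarrow> 'a::euclidean_space set) set \<Rightarrow> nat \<Rightarrow> ereal" where
  "optimal_error P M n = (INF xs\<in>knot_lists n. knots_error P M xs)"

definition Omega :: "(real \<Rightarrow> real) \<Rightarrow> real \<Rightarrow> real" where
  "Omega \<omega> x = integral {0..x} (\<lambda>t. \<omega> (t / 2))"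

text \<open>If \<open>\<omega>\<close> is a modulus of continuity that is not identically zero, then \<^term>\<open>Omega \<omega>\<close> is a
  bijection of \<open>[0,\<infinity>)\<close> onto itself, and this is its inverse.\<close>

definition Omega_inv :: "(real \<Rightarrow> real) \<Rightarrow> real \<Rightarrow> real" where
  "Omega_inv \<omega> = inv_into {0..} (Omega \<omega>)"

definition gamma_fun :: "(real \<Rightarrow> real) \<Rightarrow> real \<Rightarrow> real \<Rightarrow> real" where
  "gamma_fun \<omega> c x = Omega_inv \<omega> (c * Omega \<omega> x)"

definition B_seq :: "(real \<Rightarrow> real) \<Rightarrow> (real \<Rightarrow> real) \<Rightarrow> nat \<Rightarrow> real" where
  "B_seq P \<omega> n =
     (\<Sum>k=1..n. Omega_inv \<omega> (P ((2 * real k - 1) / (2 * real n)) * Omega \<omega> (1 / real n)))"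

end

theory Submission
  imports Defs
begin

text \<open>Write \<open>\<gamma>\<^sub>c(x)\<close> for \<^const>\<open>gamma_fun\<close>. Since \<open>\<omega>\<close> is nondecreasing and subadditive, \<open>\<Omega>\<close> is
  convex and \<open>\<Omega>(y x) \<ge> y\<^sup>2/2 \<Omega>(x)\<close> for \<open>0 < y \<le> 1\<close>. Hence \<open>c \<mapsto> \<gamma>\<^sub>c(x)/x\<close> is nondecreasing,
  subadditive, bounded on bounded sets and equicontinuous in \<open>c\<close>, uniformly in \<open>x\<close>. Monotonicity
  of \<open>\<gamma>\<^sub>c(x)/x\<close> near zero therefore yields a continuous limit \<open>l(c)\<close> as \<open>x \<rightarrow> 0\<close>, with
  convergence uniform on bounded sets (\<open>gamma_ratio_uniform\<close>). Consequently \<open>B = \<integral> l(P(t)) dt\<close>,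
  and \<open>P(t) \<Omega>(h) = \<Omega>(\<gamma>\<^sub>P\<^sub>(\<^sub>t\<^sub>)(h))\<close> behaves like \<open>\<Omega>(l(P(t)) h)\<close> for small \<open>h\<close>.

  Lower bound. The two singleton-valued functions \<open>\<plusminus>\<omega>(d(t)) e\<close>, where \<open>d(t)\<close> is the distance to
  the knots and \<open>e\<close> a unit vector, coincide at the knots, so every method has error at least
  \<open>\<integral> P(t) \<omega>(d(t)) dt\<close> (\<open>knots_error_ge\<close>). Adding to the \<open>n\<close> knots a fixed grid of \<open>K + 1\<close> points
  can only decrease \<open>d\<close> and splits \<open>[0,1]\<close> into at most \<open>n + K\<close> short gaps. A gap of length \<open>h\<close>
  contributes at least \<open>(min P) \<Omega>(h)\<close>, that is, about \<open>\<Omega>(l(min P) h)\<close>. The numbers \<open>l(min P) h\<close>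
  form a Riemann sum for \<open>B\<close>, so Jensen's inequality for \<open>\<Omega>\<close> gives about \<open>(n + K) \<Omega>(B/(n + K))\<close>
  (\<open>weighted_distance_integral_ge\<close>).

  Upper bound. Cut \<open>[0,1]\<close> into \<open>n\<close> cells on which the density \<open>l(P(t)) + \<epsilon>\<close> has equal
  integrals, take the midpoints of the cells as knots, and recover by \<open>\<Sum> c\<^sub>i conv f(x\<^sub>i)\<close>, where
  \<open>c\<^sub>i\<close> is the integral of \<open>P\<close> over the \<open>i\<close>-th cell. The error is at most \<open>\<Sum> (max P) \<Omega>(h\<^sub>i)\<close>
  (\<open>knots_error_le\<close>), and each term is at most about \<open>\<Omega>(B/n)\<close> (\<open>optimal_error_upper\<close>). As \<open>\<Omega>\<close>
  changes little when its argument is multiplied by a factor near one (\<open>Omega_near_one\<close>), both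
  bounds are asymptotically \<open>n \<Omega>(B/n)\<close>, and the limit superior is in fact a limit.

  Set-valued integrals are handled through support functions. The integral is the compact convex
  set whose support function is the integral of the support functions
  (\<open>has_rm_integral_support\<close>), because Riemann-Minkowski sums become convex as the mesh tends to
  zero: this is a form of the Shapley-Folkman theorem (\<open>Shapley_Folkman_selection\<close>).\<close>

section \<open>Partitions and Riemann sums of real functions\<close>

lemma partition_points_le:
  fixes t :: "nat \<Rightarrow> real"
  assumes "\<And>i. i \<in> {1..N} \<Longrightarrow> t (i - 1) \<le> t i" and "i \<le> j" "j \<le> N"
  shows "t i \<le> t j"
  using assms(2,3)
proof (induction rule: dec_induct)
  case base show ?case by simp
next
  case (step k)
  then show ?case using assms(1)[of "Suc k"] by auto
qed

lemma integral_partition: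
  fixes t :: "nat \<Rightarrow> real" and F :: "real \<Rightarrow> real"
  assumes le: "\<And>i. i \<in> {1..N} \<Longrightarrow> t (i - 1) \<le> t i" and F: "F integrable_on {t 0..t N}"
  shows "integral {t 0..t N} F = (\<Sum>i=1..N. integral {t (i - 1)..t i} F)"
proof -
  have "integral {t 0..t k} F = (\<Sum>i=1..k. integral {t (i - 1)..t i} F)" if "k \<le> N" for k
    using that
  proof (induction k)
    case 0
    then show ?case by simp
  next
    case (Suc k)
    have k: "t 0 \<le> t k" "t k \<le> t (Suc k)" "t (Suc k) \<le> t N"
      using Suc.prems partition_points_le[of N t 0 k] partition_points_le[of N t k "Suc k"]
        partition_points_le[of N t "Suc k" N] le by auto
    have "F integrable_on {t 0..t (Suc k)}"
      by (rule integrable_subinterval_real[OF F]) (use k in auto)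
    from Henstock_Kurzweil_Integration.integral_combine[OF k(1,2) this] show ?case
      using Suc by simp
  qed
  then show ?thesis by simp
qed

lemma sum_partition_lengths:
  fixes t :: "nat \<Rightarrow> real"
  shows "(\<Sum>i=1..N. t i - t (i - 1)) = t N - t 0"
  by (induction N) auto

lemma mesh_bound:
  assumes "i \<in> {1..N}"
  shows "t i - t (i - 1) \<le> mesh N t"
  unfolding mesh_def using assms by (intro Max_ge) auto

lemma tagged_partitionD:
  assumes "tagged_partition N t \<xi>"
  shows "t 0 = 0" "t N = 1" "N > 0"
    and "\<And>i. i \<in> {1..N} \<Longrightarrow> t (i - 1) < t i"
    and "\<And>i. i \<in> {1..N} \<Longrightarrow> \<xi> i \<in> {t (i - 1)..t i}"
    and "\<And>i. i \<in> {1..N} \<Longrightarrow> {t (i - 1)..t i} \<subseteq> {0..1}"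
    and "\<And>i. i \<in> {1..N} \<Longrightarrow> \<xi> i \<in> {0..1}"
proof -
  note a = assms[unfolded tagged_partition_def]
  show t: "t 0 = 0" "t N = 1" using a by auto
  show "N > 0" using t by (cases N) auto
  show lt: "\<And>i. i \<in> {1..N} \<Longrightarrow> t (i - 1) < t i" and x: "\<And>i. i \<in> {1..N} \<Longrightarrow> \<xi> i \<in> {t (i - 1)..t i}"
    using a by auto
  show sub: "{t (i - 1)..t i} \<subseteq> {0..1}" if "i \<in> {1..N}" for i
    using partition_points_le[of N t 0 "i - 1"] partition_points_le[of N t i N] lt that t
    by (auto intro: less_imp_le) (fastforce intro: less_imp_le)+
  show "\<xi> i \<in> {0..1}" if "i \<in> {1..N}" for i
    using x[OF that] sub[OF that] by auto
qed

text \<open>The bound depends on the integrand only through its oscillation, so it is uniform over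
  equicontinuous families such as the support functions of a set-valued function.\<close>

lemma riemann_sum_error:
  fixes F :: "real \<Rightarrow> real"
  assumes tp: "tagged_partition N t \<xi>" and mesh: "mesh N t \<le> \<eta>"
    and F: "continuous_on {0..1} F"
    and osc: "\<And>x y. x \<in> {0..1} \<Longrightarrow> y \<in> {0..1} \<Longrightarrow> \<bar>x - y\<bar> \<le> \<eta> \<Longrightarrow> \<bar>F x - F y\<bar> \<le> e"
  shows "\<bar>(\<Sum>i=1..N. (t i - t (i - 1)) * F (\<xi> i)) - integral {0..1} F\<bar> \<le> e"
proof -
  note T = tagged_partitionD[OF tp]
  have int: "integral {0..1} F = (\<Sum>i=1..N. integral {t (i - 1)..t i} F)"
    using integral_partition[of N t F] T(4) integrable_continuous_interval[OF F]
    by (simp add: T(1,2) less_imp_le)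
  have piece: "\<bar>(t i - t (i - 1)) * F (\<xi> i) - integral {t (i - 1)..t i} F\<bar> \<le> e * (t i - t (i - 1))"
    if i: "i \<in> {1..N}" for i
  proof -
    have cont: "continuous_on {t (i - 1)..t i} F"
      using F T(6)[OF i] continuous_on_subset by blast
    have le: "t (i - 1) \<le> t i" using T(4)[OF i] by simp
    have "(t i - t (i - 1)) * F (\<xi> i) - integral {t (i - 1)..t i} F
        = integral {t (i - 1)..t i} (\<lambda>x. F (\<xi> i) - F x)"
      using le cont by (subst integral_diff) (auto intro!: integrable_continuous_interval)
    also have "\<bar>\<dots>\<bar> \<le> e * (t i - t (i - 1))"
      unfolding real_norm_def[symmetric]
    proof (rule integral_bound[OF le])
      show "continuous_on {t (i - 1)..t i} (\<lambda>x. F (\<xi> i) - F x)"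
        using cont by (intro continuous_intros)
      fix x assume x: "x \<in> {t (i - 1)..t i}"
      have "\<bar>\<xi> i - x\<bar> \<le> \<eta>"
        using x T(5)[OF i] mesh_bound[OF i, of t] mesh by auto
      then show "norm (F (\<xi> i) - F x) \<le> e"
        using osc[of "\<xi> i" x] T(7)[OF i] T(6)[OF i] x by auto
    qed
    finally show ?thesis .
  qed
  have "\<bar>(\<Sum>i=1..N. (t i - t (i - 1)) * F (\<xi> i)) - integral {0..1} F\<bar>
      \<le> (\<Sum>i=1..N. e * (t i - t (i - 1)))"
    unfolding int sum_subtractf[symmetric]
    by (rule order_trans[OF sum_abs sum_mono]) (use piece in auto)
  also have "\<dots> = e"
    unfolding sum_distrib_left[symmetric] sum_partition_lengths by (simp add: T)
  finally show ?thesis .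
qed

lemma uniform_tagged_partition:
  assumes "n > 0" and "\<And>i. i \<in> {1..n} \<Longrightarrow> \<xi> i \<in> {real (i - 1) / real n..real i / real n}"
  shows "tagged_partition n (\<lambda>i. real i / real n) \<xi>" "mesh n (\<lambda>i. real i / real n) = 1 / real n"
proof -
  show "tagged_partition n (\<lambda>i. real i / real n) \<xi>"
    unfolding tagged_partition_def using assms by (auto simp: divide_strict_right_mono)
  have "(\<lambda>i. real i / real n - real (i - 1) / real n) ` {1..n} = {1 / real n}"
    using assms(1) by (force simp: image_iff field_simps of_nat_diff)
  then show "mesh n (\<lambda>i. real i / real n) = 1 / real n"
    unfolding mesh_def by simp
qed

lemma uniform_partition_exists:
  assumes "\<eta> > 0"
  obtains N t \<xi> where "tagged_partition N t \<xi>" "mesh N t < \<eta>"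
proof -
  obtain n where n: "n > 0" "1 / real n < \<eta>"
    using assms by (metis inverse_eq_divide reals_Archimedean zero_less_Suc)
  show ?thesis
  proof (rule that)
    show "tagged_partition n (\<lambda>i. real i / real n) (\<lambda>i. real i / real n)"
      using n(1) by (intro uniform_tagged_partition(1)) (auto simp: divide_right_mono)
    show "mesh n (\<lambda>i. real i / real n) < \<eta>"
      using n uniform_tagged_partition(2)[of n "\<lambda>i. real i / real n"]
        by (simp add: divide_right_mono)
  qed
qed

lemma uniformly_continuous_unit_interval:
  fixes F :: "real \<Rightarrow> real"
  assumes "continuous_on {0..1} F" "e > 0"
  obtains \<eta> where "\<eta> > 0"
    "\<And>x y. x \<in> {0..1} \<Longrightarrow> y \<in> {0..1} \<Longrightarrow> \<bar>x - y\<bar> \<le> \<eta> \<Longrightarrow> \<bar>F x - F y\<bar> \<le> e"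
proof -
  have "uniformly_continuous_on {0..1} F"
    using assms by (intro compact_uniformly_continuous) auto
  then obtain d where "d > 0" "\<And>x y. x \<in> {0..1} \<Longrightarrow> y \<in> {0..1} \<Longrightarrow> dist y x < d \<Longrightarrow> dist (F y) (F x) < e"
    unfolding uniformly_continuous_on_def using assms(2) by metis
  then show ?thesis
    by (intro that[of "d / 2"]) (force simp: dist_real_def abs_minus_commute)+
qed

section \<open>Moduli of continuity and the function Omega\<close>

lemma has_integral_affine_real:
  fixes f :: "real \<Rightarrow> real"
  assumes "(f has_integral i) {m * a + c..m * b + c}" "m > 0"
  shows "((\<lambda>x. f (m * x + c)) has_integral i / m) {a..b}"
proof -
  have "((\<lambda>x. f (m *\<^sub>R x + c)) has_integral (i /\<^sub>R m ^ DIM(real)))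
      (cbox ((m * a + c - c) /\<^sub>R m) ((m * b + c - c) /\<^sub>R m))"
    using assms by (intro has_integral_affinity') auto
  moreover have "(m * a + c - c) /\<^sub>R m = a" "(m * b + c - c) /\<^sub>R m = b" "i /\<^sub>R m ^ DIM(real)
    = i / m"
    using assms(2) by (simp_all add: field_simps)
  ultimately show ?thesis by (simp only: real_scaleR_def cbox_interval)
qed

text \<open>Moduli of continuity that do not vanish identically.\<close>

locale modulus =
  fixes \<omega> :: "real \<Rightarrow> real"
  assumes modulus: "modulus_of_continuity \<omega>" and nontrivial: "\<exists>t\<ge>0. \<omega> t \<noteq> 0"
begin

lemma modulus_nonneg: "t \<ge> 0 \<Longrightarrow> \<omega> t \<ge> 0"
  and modulus_0: "\<omega> 0 = 0"
  and modulus_cont: "continuous_on {0..} \<omega>"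
  and modulus_mono: "0 \<le> s \<Longrightarrow> s \<le> t \<Longrightarrow> \<omega> s \<le> \<omega> t"
  and modulus_add: "0 \<le> s \<Longrightarrow> 0 \<le> t \<Longrightarrow> \<omega> (s + t) \<le> \<omega> s + \<omega> t"
  using modulus unfolding modulus_of_continuity_def mono_on_def by auto

lemma modulus_multiple: "t \<ge> 0 \<Longrightarrow> \<omega> (real k * t) \<le> real k * \<omega> t"
proof (induction k)
  case (Suc k)
  have "\<omega> (real (Suc k) * t) = \<omega> (real k * t + t)" by (simp add: algebra_simps)
  also have "\<dots> \<le> \<omega> (real k * t) + \<omega> t" using Suc by (intro modulus_add) auto
  also have "\<dots> \<le> real (Suc k) * \<omega> t" using Suc by (simp add: algebra_simps)
  finally show ?case .
qed (simp add: modulus_0)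

lemma modulus_pos:
  assumes "t > 0" shows "\<omega> t > 0"
proof (rule ccontr)
  assume "\<not> \<omega> t > 0"
  then have t0: "\<omega> t = 0" using modulus_nonneg[of t] assms by simp
  obtain s where s: "s \<ge> 0" "\<omega> s \<noteq> 0" using nontrivial by auto
  obtain k where k: "s \<le> real k * t" using reals_Archimedean3[OF assms] by (meson less_imp_le)
  have "\<omega> s \<le> real k * \<omega> t"
    using modulus_mono[OF s(1) k] modulus_multiple[of t k] assms by simp
  then show False using t0 s modulus_nonneg[of s] by simp
qed

lemma modulus_scale:
  assumes "0 < y" "y \<le> 1" "0 \<le> s"
  shows "\<omega> (y * s) \<ge> y / 2 * \<omega> s"
proof -
  define k where "k = nat \<lceil>1 / y\<rceil>"
  have k: "real k \<ge> 1 / y" "real k \<le> 2 / y"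
  proof -
    have y: "1 / y \<ge> 1" using assms by simp
    show "real k \<ge> 1 / y" unfolding k_def by (rule real_nat_ceiling_ge)
    have "real k = of_int \<lceil>1 / y\<rceil>" unfolding k_def using y by simp
    also have "\<dots> \<le> 1 / y + 1" by (rule of_int_ceiling_le_add_one)
    also have "\<dots> \<le> 1 / y + 1 / y" using y by simp
    finally show "real k \<le> 2 / y" by simp
  qed
  have "\<omega> s \<le> \<omega> (real k * (y * s))"
  proof (rule modulus_mono[OF assms(3)])
    have "1 * s \<le> (real k * y) * s" using k(1) assms
      by (intro mult_right_mono) (auto simp: field_simps)
    then show "s \<le> real k * (y * s)" by (simp add: mult.assoc)
  qed
  also have "\<dots> \<le> real k * \<omega> (y * s)" using assms by (intro modulus_multiple) auto
  also have "\<dots> \<le> 2 / y * \<omega> (y * s)"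
    using k(2) assms by (intro mult_right_mono modulus_nonneg) auto
  finally show ?thesis using assms by (simp add: field_simps)
qed

lemma modulus_small:
  assumes "e > 0" obtains \<eta> where "\<eta> > 0" "\<omega> \<eta> \<le> e"
proof -
  obtain d where d: "d > 0" "\<And>x. x \<in> {0..} \<Longrightarrow> dist x 0 < d \<Longrightarrow> dist (\<omega> x) (\<omega> 0) < e"
    using modulus_cont assms unfolding continuous_on_iff by (metis atLeast_iff order_refl)
  show ?thesis using d(1) d(2)[of "d / 2"] modulus_0
    by (intro that[of "d / 2"]) (auto simp: dist_real_def)
qed

lemma modulus_half_cont: "continuous_on {0..} (\<lambda>t. \<omega> (t / 2))"
  by (rule continuous_on_compose2[OF modulus_cont]) (auto intro!: continuous_intros)

lemma modulus_half_integrable: "0 \<le> a \<Longrightarrow> (\<lambda>t. \<omega> (t / 2)) integrable_on {a..b}"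
  by (rule integrable_continuous_interval, rule continuous_on_subset[OF modulus_half_cont]) auto

lemma Omega_diff:
  assumes "0 \<le> x" "x \<le> y"
  shows "Omega \<omega> y - Omega \<omega> x = integral {x..y} (\<lambda>t. \<omega> (t / 2))"
  using Henstock_Kurzweil_Integration.integral_combine[OF assms modulus_half_integrable[of 0 y]]
    unfolding Omega_def by simp

lemma Omega_0 [simp]: "Omega \<omega> 0 = 0"
  by (simp add: Omega_def)

text \<open>Supporting lines of the convex function \<open>\<Omega>\<close>; all convexity properties used below follow
  from it.\<close>

lemma Omega_tangent:
  assumes "0 \<le> x" "0 \<le> y"
  shows "Omega \<omega> y \<ge> Omega \<omega> x + \<omega> (x / 2) * (y - x)"
proof (cases "x \<le> y")
  case True
  have "\<omega> (x / 2) * (y - x) = integral {x..y} (\<lambda>t. \<omega> (x / 2))" using True by simp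
  also have "\<dots> \<le> integral {x..y} (\<lambda>t. \<omega> (t / 2))"
    using assms by (intro integral_le modulus_half_integrable) (auto intro!: modulus_mono)
  finally show ?thesis using Omega_diff[OF assms(1) True] by simp
next
  case False
  have "integral {y..x} (\<lambda>t. \<omega> (t / 2)) \<le> integral {y..x} (\<lambda>t. \<omega> (x / 2))"
    using assms by (intro integral_le modulus_half_integrable) (auto intro!: modulus_mono)
  also have "\<dots> = \<omega> (x / 2) * (x - y)" using False by simp
  finally show ?thesis using Omega_diff[OF assms(2), of x] False by (simp add: algebra_simps)
qed

lemma Omega_strict_mono:
  assumes "0 \<le> x" "x < y" shows "Omega \<omega> x < Omega \<omega> y"
proof (cases "x = 0")
  case False
  have "0 < \<omega> (x / 2) * (y - x)" using assms False modulus_pos[of "x / 2"] by simp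
  then show ?thesis using Omega_tangent[of x y] assms by linarith
next
  case True
  have "0 < \<omega> (y / 4) * (y / 2)" using assms modulus_pos[of "y / 4"] by simp
  moreover have "0 \<le> Omega \<omega> (y / 2)"
    using Omega_tangent[of 0 "y/2"] assms modulus_0 by simp
  ultimately show ?thesis using Omega_tangent[of "y / 2" y] assms True by (simp add: algebra_simps)
qed

lemma Omega_mono: "0 \<le> x \<Longrightarrow> x \<le> y \<Longrightarrow> Omega \<omega> x \<le> Omega \<omega> y"
  using Omega_strict_mono[of x y] by (cases "x = y") auto

lemma Omega_nonneg: "0 \<le> x \<Longrightarrow> 0 \<le> Omega \<omega> x"
  using Omega_mono[of 0 x] by simp

lemma Omega_pos: "0 < x \<Longrightarrow> 0 < Omega \<omega> x"
  using Omega_strict_mono[of 0 x] by simp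

lemma Omega_le_iff: "0 \<le> x \<Longrightarrow> 0 \<le> y \<Longrightarrow> Omega \<omega> x \<le> Omega \<omega> y \<longleftrightarrow> x \<le> y"
  using Omega_strict_mono[of y x] Omega_mono[of x y] by force

lemma Omega_bij: "bij_betw (Omega \<omega>) {0..} {0..}"
  unfolding bij_betw_def
proof
  show "inj_on (Omega \<omega>) {0..}"
    by (rule linorder_inj_onI) (use Omega_strict_mono in \<open>force+\<close>)
  show "Omega \<omega> ` {0..} = {0..}"
  proof (intro subset_antisym subsetI)
    fix v :: real assume "v \<in> Omega \<omega> ` {0..}"
    then show "v \<in> {0..}" using Omega_nonneg by auto
  next
    fix v :: real assume v: "v \<in> {0..}"
    define b where "b = 1 + v / \<omega> (1/2)"
    have w: "\<omega> (1/2) > 0" by (rule modulus_pos) simp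
    have b: "b \<ge> 1" unfolding b_def using v w by simp
    have "v \<le> Omega \<omega> b"
      using Omega_tangent[of 1 b] b Omega_nonneg[of 1] w unfolding b_def by simp
    moreover have "continuous_on {0..b} (Omega \<omega>)"
      unfolding Omega_def by (rule indefinite_integral_continuous_1[OF modulus_half_integrable]) simp
    ultimately obtain x where "0 \<le> x" "x \<le> b" "Omega \<omega> x = v"
      using IVT'[of "Omega \<omega>" 0 v b] v b by auto
    then show "v \<in> Omega \<omega> ` {0..}" by auto
  qed
qed

lemma Omega_inv:
  assumes "0 \<le> v"
  shows "0 \<le> Omega_inv \<omega> v" "Omega \<omega> (Omega_inv \<omega> v) = v"
proof -
  have v: "v \<in> Omega \<omega> ` {0..}" using Omega_bij assms by (simp add: bij_betw_def)
  show "0 \<le> Omega_inv \<omega> v" "Omega \<omega> (Omega_inv \<omega> v) = v"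
    unfolding Omega_inv_def using inv_into_into[OF v] f_inv_into_f[OF v] by auto
qed

lemma Omega_star_shaped:
  assumes "0 \<le> l" "l \<le> 1" "0 \<le> x"
  shows "Omega \<omega> (l * x) \<le> l * Omega \<omega> x"
proof -
  let ?z = "l * x"
  have "l * (Omega \<omega> ?z + \<omega> (?z / 2) * (x - ?z)) \<le> l * Omega \<omega> x"
    using assms by (intro mult_left_mono Omega_tangent) auto
  moreover have "(1 - l) * (Omega \<omega> ?z + \<omega> (?z / 2) * (0 - ?z)) \<le> (1 - l) * Omega \<omega> 0"
    using assms by (intro mult_left_mono Omega_tangent) auto
  ultimately show ?thesis by (simp add: algebra_simps)
qed

lemma Omega_superadditive:
  assumes "0 \<le> a" "0 \<le> b"
  shows "Omega \<omega> a + Omega \<omega> b \<le> Omega \<omega> (a + b)"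
proof (cases "a + b = 0")
  case False
  then have ab: "a + b > 0" using assms by simp
  have "Omega \<omega> a \<le> a / (a + b) * Omega \<omega> (a + b)"
    using Omega_star_shaped[of "a / (a + b)" "a + b"] ab assms by simp
  moreover have "Omega \<omega> b \<le> b / (a + b) * Omega \<omega> (a + b)"
    using Omega_star_shaped[of "b / (a + b)" "a + b"] ab assms by simp
  moreover have "a / (a + b) * Omega \<omega> (a + b) + b / (a + b) * Omega \<omega> (a + b) = Omega \<omega> (a + b)"
    using ab by (simp add: add_divide_distrib[symmetric] distrib_right[symmetric])
  ultimately show ?thesis by linarith
next
  case True
  then have "a = 0" "b = 0" using assms by auto
  then show ?thesis by simp
qed

lemma Omega_rescale:
  assumes "0 < y" "0 \<le> x"
  shows "Omega \<omega> (y * x) = y * integral {0..x} (\<lambda>t. \<omega> (y * t / 2))"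
proof -
  have "((\<lambda>t. \<omega> (t / 2)) has_integral Omega \<omega> (y * x)) {y * 0 + 0..y * x + 0}"
    unfolding Omega_def using modulus_half_integrable[of 0] by (simp add: integrable_integral)
  from has_integral_affine_real[OF this assms(1)]
  have "((\<lambda>t. \<omega> (y * t / 2)) has_integral Omega \<omega> (y * x) / y) {0..x}"
    by simp
  then show ?thesis using assms by (simp add: integral_unique)
qed

text \<open>The lower growth bound coming from subadditivity of \<open>\<omega>\<close>; it makes \<open>\<gamma>\<^sub>c(x)/x\<close> small for
  small \<open>c\<close>, uniformly in \<open>x\<close>.\<close>

lemma Omega_quadratic:
  assumes "0 < y" "y \<le> 1" "0 \<le> x"
  shows "Omega \<omega> (y * x) \<ge> y\<^sup>2 / 2 * Omega \<omega> x"
proof -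
  have "y / 2 * Omega \<omega> x = integral {0..x} (\<lambda>t. y / 2 * \<omega> (t / 2))"
    by (simp add: Omega_def)
  also have "\<dots> \<le> integral {0..x} (\<lambda>t. \<omega> (y * t / 2))"
  proof (rule integral_le)
    show "(\<lambda>t. y / 2 * \<omega> (t / 2)) integrable_on {0..x}"
      using modulus_half_integrable[of 0 x] by (intro integrable_on_mult_right) auto
    show "(\<lambda>t. \<omega> (y * t / 2)) integrable_on {0..x}"
      by (rule integrable_continuous_interval, rule continuous_on_compose2[OF modulus_cont])
        (use assms in \<open>auto intro!: continuous_intros\<close>)
    show "y / 2 * \<omega> (t / 2) \<le> \<omega> (y * t / 2)" if "t \<in> {0..x}" for t
      using modulus_scale[OF assms(1,2), of "t / 2"] that by simp
  qed
  finally have "y * (y / 2 * Omega \<omega> x) \<le> y * integral {0..x} (\<lambda>t. \<omega> (y * t / 2))"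
    using assms by (intro mult_left_mono) auto
  then show ?thesis
    using Omega_rescale[OF assms(1,3)] by (simp add: power2_eq_square)
qed

text \<open>Scaling the argument by a factor near one changes \<open>\<Omega>\<close> by a factor near one. This combines
  the tangent at \<open>x\<close> with the inequality \<open>x \<omega>(x/2) \<le> 4 \<Omega>(x)\<close>.\<close>

lemma Omega_near_one:
  assumes "0 \<le> l" "l \<le> 1" "0 \<le> x"
  shows "Omega \<omega> (l * x) \<ge> (1 - 4 * (1 - l)) * Omega \<omega> x"
proof -
  have "\<omega> (x / 2) \<le> 2 * \<omega> (x / 4)" using modulus_add[of "x/4" "x/4"] assms by simp
  then have "x * \<omega> (x / 2) \<le> x * (2 * \<omega> (x / 4))" using assms by (intro mult_left_mono)
  moreover have "\<omega> (x / 4) * (x / 2) \<le> Omega \<omega> x"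
    using Omega_tangent[of "x/2" x] assms Omega_nonneg[of "x/2"] by simp
  ultimately have *: "x * \<omega> (x / 2) \<le> 4 * Omega \<omega> x" by (simp add: mult.commute)
  have "Omega \<omega> x - (1 - l) * (x * \<omega> (x / 2)) \<le> Omega \<omega> (l * x)"
    using Omega_tangent[of x "l * x"] assms by (simp add: algebra_simps)
  moreover have "(1 - l) * (x * \<omega> (x / 2)) \<le> (1 - l) * (4 * Omega \<omega> x)"
    using assms by (intro mult_left_mono *) auto
  ultimately show ?thesis by (simp add: algebra_simps)
qed

lemma Omega_jensen:
  assumes "finite I" "I \<noteq> {}" "\<And>i. i \<in> I \<Longrightarrow> 0 \<le> y i"
  shows "real (card I) * Omega \<omega> ((\<Sum>i\<in>I. y i) / real (card I)) \<le> (\<Sum>i\<in>I. Omega \<omega> (y i))"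
proof -
  define m where "m = (\<Sum>i\<in>I. y i) / real (card I)"
  have c: "real (card I) > 0" using assms by (simp add: card_gt_0_iff)
  have m: "m \<ge> 0" unfolding m_def using assms by (simp add: sum_nonneg)
  have "(\<Sum>i\<in>I. Omega \<omega> m + \<omega> (m / 2) * (y i - m)) \<le> (\<Sum>i\<in>I. Omega \<omega> (y i))"
    using m assms by (intro sum_mono Omega_tangent) auto
  moreover have "(\<Sum>i\<in>I. Omega \<omega> m + \<omega> (m / 2) * (y i - m))
      = real (card I) * Omega \<omega> m + \<omega> (m / 2) * ((\<Sum>i\<in>I. y i) - real (card I) * m)"
    by (simp add: sum.distrib sum_distrib_left[symmetric] sum_subtractf)
  moreover have "(\<Sum>i\<in>I. y i) - real (card I) * m = 0" unfolding m_def using c by simp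
  ultimately show ?thesis unfolding m_def by simp
qed

text \<open>Dividing a length \<open>c\<close> into a larger number of equal parts does not increase the total of \<open>\<Omega>\<close>.\<close>

lemma Omega_split_antimono:
  assumes "0 < M" "M \<le> N" "0 \<le> (c::real)"
  shows "real N * Omega \<omega> (c / real N) \<le> real M * Omega \<omega> (c / real M)"
proof -
  have "Omega \<omega> (real M / real N * (c / real M)) \<le> real M / real N * Omega \<omega> (c / real M)"
    using assms by (intro Omega_star_shaped) auto
  then show ?thesis using assms by (simp add: field_simps)
qed

lemma has_integral_modulus:
  assumes "h \<ge> 0"
  shows "(\<omega> has_integral Omega \<omega> (2 * h) / 2) {0..h}"
proof -
  have "((\<lambda>t. \<omega> (t / 2)) has_integral Omega \<omega> (2 * h)) {2 * 0 + 0..2 * h + 0}"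
    unfolding Omega_def using modulus_half_integrable[of 0] by (simp add: integrable_integral)
  from has_integral_affine_real[OF this] show ?thesis by simp
qed

lemma has_integral_modulus_left:
  assumes "a \<le> m"
  shows "((\<lambda>t. \<omega> (t - a)) has_integral Omega \<omega> (2 * (m - a)) / 2) {a..m}"
  using has_integral_affine_real[of \<omega> "Omega \<omega> (2 * (m - a)) / 2" 1 a "- a" m]
    has_integral_modulus[of "m - a"] assms by simp

lemma has_integral_modulus_right:
  assumes "m \<le> b"
  shows "((\<lambda>t. \<omega> (b - t)) has_integral Omega \<omega> (2 * (b - m)) / 2) {m..b}"
proof -
  have "((\<lambda>t. \<omega> (- t)) has_integral Omega \<omega> (2 * (b - m)) / 2) {-(b - m)..-0}"
    using has_integral_modulus[of "b - m"] assms by (subst has_integral_reflect_real) auto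
  then show ?thesis
    using has_integral_affine_real[of "\<lambda>t. \<omega> (- t)" "Omega \<omega> (2 * (b - m)) / 2" 1 m "- b" b] by simp
qed

text \<open>The integral of \<open>\<omega>\<close> of the distance to the two endpoints of a gap; the factor \<open>1/2\<close> in the
  definition of \<open>\<Omega>\<close> is made for this and for the next identity, with the distance to the
  midpoint.\<close>

lemma has_integral_modulus_gap:
  assumes "a \<le> b"
  shows "((\<lambda>t. \<omega> (min (t - a) (b - t))) has_integral Omega \<omega> (b - a)) {a..b}"
proof -
  define m where "m = (a + b) / 2"
  have m: "a \<le> m" "m \<le> b" "2 * (m - a) = b - a" "2 * (b - m) = b - a"
    using assms unfolding m_def by (simp_all add: field_simps)
  have "((\<lambda>t. \<omega> (min (t - a) (b - t))) has_integral Omega \<omega> (b - a) / 2) {a..m}"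
    by (rule has_integral_eq[OF _ has_integral_modulus_left[OF m(1), unfolded m(3)]])
      (use m in \<open>auto simp: min_def\<close>)
  moreover have "((\<lambda>t. \<omega> (min (t - a) (b - t))) has_integral Omega \<omega> (b - a) / 2) {m..b}"
    by (rule has_integral_eq[OF _ has_integral_modulus_right[OF m(2), unfolded m(4)]])
      (use m in \<open>auto simp: min_def intro!: arg_cong[where f = \<omega>]\<close>)
  ultimately show ?thesis
    by (rule has_integral_combine[OF m(1,2), where i = "Omega \<omega> (b - a) / 2"
          and j = "Omega \<omega> (b - a) / 2", simplified])
qed

lemma has_integral_modulus_midpoint:
  assumes "a \<le> b"
  shows "((\<lambda>t. \<omega> \<bar>t - (a + b) / 2\<bar>) has_integral Omega \<omega> (b - a)) {a..b}"
proof -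
  define m where "m = (a + b) / 2"
  have m: "a \<le> m" "m \<le> b" "2 * (m - a) = b - a" "2 * (b - m) = b - a"
    using assms unfolding m_def by (simp_all add: field_simps)
  have "((\<lambda>t. \<omega> \<bar>t - m\<bar>) has_integral Omega \<omega> (b - a) / 2) {a..m}"
    by (rule has_integral_eq[OF _ has_integral_modulus_right[OF m(1), unfolded m(3)]]) auto
  moreover have "((\<lambda>t. \<omega> \<bar>t - m\<bar>) has_integral Omega \<omega> (b - a) / 2) {m..b}"
    by (rule has_integral_eq[OF _ has_integral_modulus_left[OF m(2), unfolded m(4)]]) auto
  ultimately show ?thesis unfolding m_def[symmetric]
    by (rule has_integral_combine[OF m(1,2), where i = "Omega \<omega> (b - a) / 2"
          and j = "Omega \<omega> (b - a) / 2", simplified])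
qed

end

section \<open>The limit of the ratio of gamma to its argument\<close>

lemma monotone_bounded_limit_at_right:
  fixes f :: "real \<Rightarrow> real"
  assumes \<epsilon>: "\<epsilon> > 0" and mono: "mono_on {0<..<\<epsilon>} f \<or> antimono_on {0<..<\<epsilon>} f"
    and bound: "\<And>x. 0 < x \<Longrightarrow> \<bar>f x\<bar> \<le> K"
  shows "\<exists>L. (f \<longlongrightarrow> L) (at_right 0)"
proof -
  have increasing: "\<exists>L. (g \<longlongrightarrow> L) (at_right 0)"
    if m: "mono_on {0<..<\<epsilon>} g" and b: "\<And>x. 0 < x \<Longrightarrow> \<bar>g x\<bar> \<le> K" for g :: "real \<Rightarrow> real"
  proof
    let ?S = "g ` {0<..<\<epsilon>}"
    have bdd: "bdd_below ?S"
      by (rule bdd_belowI[of _ "-K"]) (use b in \<open>force simp: abs_le_iff\<close>)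
    show "(g \<longlongrightarrow> Inf ?S) (at_right 0)"
    proof (rule tendstoI)
      fix e :: real assume e: "e > 0"
      have "?S \<noteq> {}" using \<epsilon> by (auto intro: exI[of _ "\<epsilon> / 2"])
      then obtain y where y: "y \<in> {0<..<\<epsilon>}" "g y < Inf ?S + e"
        using cInf_lessD[of ?S "Inf ?S + e"] e by auto
      have "dist (g x) (Inf ?S) < e" if x: "x \<in> {0<..<y}" for x
      proof -
        have "Inf ?S \<le> g x" using x y by (intro cInf_lower[OF _ bdd]) auto
        moreover have "g x \<le> g y" using m x y unfolding mono_on_def by auto
        ultimately show ?thesis using y by (simp add: dist_real_def)
      qed
      then show "\<forall>\<^sub>F x in at_right 0. dist (g x) (Inf ?S) < e"
        using y by (auto simp: eventually_at_right_field intro!: exI[of _ y])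
    qed
  qed
  from mono show ?thesis
  proof
    assume "mono_on {0<..<\<epsilon>} f"
    then show ?thesis by (rule increasing) (use bound in auto)
  next
    assume "antimono_on {0<..<\<epsilon>} f"
    then have "mono_on {0<..<\<epsilon>} (\<lambda>x. - f x)" by (auto simp: monotone_on_def)
    then obtain L where "((\<lambda>x. - f x) \<longlongrightarrow> L) (at_right 0)"
      using increasing[of "\<lambda>x. - f x"] bound by auto
    from tendsto_minus[OF this] show ?thesis by auto
  qed
qed

lemma sqrt_small:
  assumes "(0::real) < e" 
  shows "\<exists>d>0. d \<le> 1/2 \<and> sqrt (2 * d) \<le> e"
proof -
  let ?d = "min (1/2) (e\<^sup>2 / 2)"
  have "sqrt (2 * ?d) \<le> sqrt (e\<^sup>2)" by (subst real_sqrt_le_iff) auto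
  then show ?thesis using assms by (intro exI[of _ ?d]) auto
qed

text \<open>The limit \<open>l(c)\<close> of \<open>\<gamma>\<^sub>c(x)/x\<close> as \<open>x\<close> decreases to zero; it exists for \<open>c \<ge> 0\<close> under the
  monotonicity hypothesis of the locale \<open>regular_modulus\<close> below.\<close>

definition gamma_limit :: "(real \<Rightarrow> real) \<Rightarrow> real \<Rightarrow> real" where
  "gamma_limit \<omega> c = Lim (at_right 0) (\<lambda>x. gamma_fun \<omega> c x / x)"

context modulus begin

lemma gamma_fun:
  assumes "0 \<le> c" "0 \<le> x"
  shows "0 \<le> gamma_fun \<omega> c x" "Omega \<omega> (gamma_fun \<omega> c x) = c * Omega \<omega> x"
  unfolding gamma_fun_def using Omega_inv[of "c * Omega \<omega> x"] Omega_nonneg[OF assms(2)] assms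
    by auto

lemma gamma_fun_le:
  assumes "0 \<le> c" "0 \<le> x" "0 \<le> y" "c * Omega \<omega> x \<le> Omega \<omega> y"
  shows "gamma_fun \<omega> c x \<le> y"
  using Omega_le_iff[OF gamma_fun(1)[OF assms(1,2)] assms(3)] gamma_fun(2)[OF assms(1,2)] assms
    by simp

lemma gamma_fun_ge:
  assumes "0 \<le> c" "0 \<le> x" "0 \<le> y" "Omega \<omega> y \<le> c * Omega \<omega> x"
  shows "y \<le> gamma_fun \<omega> c x"
  using Omega_le_iff[OF assms(3) gamma_fun(1)[OF assms(1,2)]] gamma_fun(2)[OF assms(1,2)] assms
    by simp

lemma gamma_fun_mono:
  assumes "0 \<le> c" "c \<le> d" "0 \<le> x"
  shows "gamma_fun \<omega> c x \<le> gamma_fun \<omega> d x"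
  using assms gamma_fun[of d x] Omega_nonneg[of x]
    by (intro gamma_fun_le) (auto intro: mult_right_mono)

lemma gamma_fun_add:
  assumes "0 \<le> c" "0 \<le> d" "0 \<le> x"
  shows "gamma_fun \<omega> (c + d) x \<le> gamma_fun \<omega> c x + gamma_fun \<omega> d x"
proof (rule gamma_fun_le)
  show "(c + d) * Omega \<omega> x \<le> Omega \<omega> (gamma_fun \<omega> c x + gamma_fun \<omega> d x)"
    using Omega_superadditive[of "gamma_fun \<omega> c x" "gamma_fun \<omega> d x"] gamma_fun[of c x] gamma_fun[of d x] assms
    by (simp add: algebra_simps)
qed (use assms gamma_fun in auto)

lemma gamma_fun_small:
  assumes "0 \<le> d" "2 * d \<le> 1" "0 \<le> x"
  shows "gamma_fun \<omega> d x \<le> sqrt (2 * d) * x"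
proof (cases "d = 0")
  case True
  then show ?thesis using gamma_fun_le[of 0 x 0] assms by simp
next
  case False
  show ?thesis
  proof (rule gamma_fun_le)
    show "d * Omega \<omega> x \<le> Omega \<omega> (sqrt (2 * d) * x)"
      using Omega_quadratic[of "sqrt (2 * d)" x] assms False by simp
  qed (use assms in auto)
qed

lemma gamma_fun_bounds:
  assumes "0 \<le> c" "0 \<le> x"
  shows "min 1 c * x \<le> gamma_fun \<omega> c x" "gamma_fun \<omega> c x \<le> max 1 c * x"
proof -
  have pos: "0 \<le> Omega \<omega> x" using Omega_nonneg assms by simp
  show "min 1 c * x \<le> gamma_fun \<omega> c x"
  proof (rule gamma_fun_ge)
    have "Omega \<omega> (min 1 c * x) \<le> min 1 c * Omega \<omega> x"
      using assms by (intro Omega_star_shaped) auto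
    also have "\<dots> \<le> c * Omega \<omega> x" using pos by (intro mult_right_mono) auto
    finally show "Omega \<omega> (min 1 c * x) \<le> c * Omega \<omega> x" .
  qed (use assms in auto)
  show "gamma_fun \<omega> c x \<le> max 1 c * x"
  proof (rule gamma_fun_le)
    define k where "k = max 1 c"
    have k: "k \<ge> 1" "k \<ge> c" unfolding k_def by auto
    have "Omega \<omega> (1 / k * (k * x)) \<le> 1 / k * Omega \<omega> (k * x)"
      using assms k by (intro Omega_star_shaped) auto
    then have "k * Omega \<omega> x \<le> Omega \<omega> (k * x)" using k by (simp add: field_simps)
    moreover have "c * Omega \<omega> x \<le> k * Omega \<omega> x" using pos k by (intro mult_right_mono) auto
    ultimately show "c * Omega \<omega> x \<le> Omega \<omega> (max 1 c * x)" unfolding k_def by simp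
  qed (use assms in auto)
qed

text \<open>Equicontinuity in \<open>c\<close>, uniformly in \<open>x\<close>.\<close>

lemma gamma_ratio_diff:
  assumes "0 \<le> c" "0 \<le> d" "\<bar>c - d\<bar> \<le> 1 / 2" "0 < x"
  shows "\<bar>gamma_fun \<omega> c x / x - gamma_fun \<omega> d x / x\<bar> \<le> sqrt (2 * \<bar>c - d\<bar>)"
proof -
  have *: "\<bar>gamma_fun \<omega> b x / x - gamma_fun \<omega> a x / x\<bar> \<le> sqrt (2 * (b - a))"
    if "0 \<le> a" "a \<le> b" "b - a \<le> 1 / 2" for a b
  proof -
    have "gamma_fun \<omega> a x \<le> gamma_fun \<omega> b x"
      using gamma_fun_mono that assms by simp
    moreover have "gamma_fun \<omega> b x \<le> gamma_fun \<omega> a x + sqrt (2 * (b - a)) * x"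
      using gamma_fun_add[of a "b - a" x] gamma_fun_small[of "b - a" x] that assms by simp
    ultimately show ?thesis
      using assms by (simp add: diff_divide_distrib[symmetric] abs_of_nonneg divide_le_eq)
  qed
  show ?thesis
  proof (cases "c \<le> d")
    case True
    then show ?thesis using *[of c d] assms by (simp add: abs_minus_commute)
  next
    case False
    then show ?thesis using *[of d c] assms by simp
  qed
qed

end

text \<open>Moduli for which every ratio \<open>\<gamma>\<^sub>c(x)/x\<close> is monotone near zero.\<close>

locale regular_modulus = modulus +
  assumes gamma_monotone: "\<And>c. c > 0 \<Longrightarrow> \<exists>\<epsilon>>0. mono_on {0<..<\<epsilon>} (\<lambda>x. gamma_fun \<omega> c x / x) \<or>
                             antimono_on {0<..<\<epsilon>} (\<lambda>x. gamma_fun \<omega> c x / x)"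
begin

lemma gamma_limit:
  assumes "0 \<le> c"
  shows "((\<lambda>x. gamma_fun \<omega> c x / x) \<longlongrightarrow> gamma_limit \<omega> c) (at_right 0)"
proof -
  have "\<exists>L. ((\<lambda>x. gamma_fun \<omega> c x / x) \<longlongrightarrow> L) (at_right 0)"
  proof (cases "c = 0")
    case True
    have "((\<lambda>x. gamma_fun \<omega> c x / x) \<longlongrightarrow> 0) (at_right 0)"
    proof (rule tendsto_eventually)
      have "gamma_fun \<omega> c x = 0" if "x > 0" for x
        using gamma_fun(1)[of c x] gamma_fun_le[of c x 0] that True by simp
      then show "\<forall>\<^sub>F x in at_right 0. gamma_fun \<omega> c x / x = 0"
        by (auto simp: eventually_at_right_field intro!: exI[of _ 1])
    qed
    then show ?thesis by blast
  next
    case False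
    then obtain \<epsilon> where "\<epsilon> > 0" "mono_on {0<..<\<epsilon>} (\<lambda>x. gamma_fun \<omega> c x / x) \<or>
                             antimono_on {0<..<\<epsilon>} (\<lambda>x. gamma_fun \<omega> c x / x)"
      using gamma_monotone[of c] assms by auto
    then show ?thesis
    proof (rule monotone_bounded_limit_at_right)
      show "\<bar>gamma_fun \<omega> c x / x\<bar> \<le> max 1 c" if "0 < x" for x
        using gamma_fun(1)[of c x] gamma_fun_bounds(2)[of c x] that assms
        by (simp add: divide_le_eq)
    qed
  qed
  then show ?thesis unfolding gamma_limit_def by (metis tendsto_Lim trivial_limit_at_right_real)
qed

lemma gamma_limit_nonneg: "0 \<le> c \<Longrightarrow> 0 \<le> gamma_limit \<omega> c"
  by (rule tendsto_lowerbound[OF gamma_limit], simp_all)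
    (rule eventually_mono[OF eventually_at_right_less], simp add: gamma_fun)

lemma gamma_limit_ge:
  assumes "0 \<le> c"
  shows "min 1 c \<le> gamma_limit \<omega> c"
proof (rule tendsto_lowerbound[OF gamma_limit[OF assms]])
  show "\<forall>\<^sub>F x in at_right 0. min 1 c \<le> gamma_fun \<omega> c x / x"
    by (rule eventually_mono[OF eventually_at_right_less])
      (use gamma_fun_bounds(1)[OF assms] in \<open>simp add: le_divide_eq\<close>)
qed simp

lemma gamma_limit_diff:
  assumes "0 \<le> c" "0 \<le> d" "\<bar>c - d\<bar> \<le> 1 / 2"
  shows "\<bar>gamma_limit \<omega> c - gamma_limit \<omega> d\<bar> \<le> sqrt (2 * \<bar>c - d\<bar>)"
proof (rule tendsto_upperbound)
  show "((\<lambda>x. \<bar>gamma_fun \<omega> c x / x - gamma_fun \<omega> d x / x\<bar>)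
    \<longlongrightarrow> \<bar>gamma_limit \<omega> c - gamma_limit \<omega> d\<bar>) (at_right 0)"
    using assms by (intro tendsto_intros gamma_limit)
  show "\<forall>\<^sub>F x in at_right 0. \<bar>gamma_fun \<omega> c x / x - gamma_fun \<omega> d x / x\<bar> \<le> sqrt (2 * \<bar>c - d\<bar>)"
    by (rule eventually_mono[OF eventually_at_right_less]) (use gamma_ratio_diff assms in auto)
qed simp

lemma gamma_limit_continuous: "continuous_on {0..} (gamma_limit \<omega>)"
  unfolding continuous_on_iff
proof (intro ballI allI impI)
  fix c :: real and e :: real
  assume c: "c \<in> {0..}" and e: "0 < e"
  obtain d where d: "d > 0" "d \<le> 1/2" "sqrt (2 * d) \<le> e / 2" using sqrt_small[of "e/2"] e by auto
  show "\<exists>d>0. \<forall>x'\<in>{0..}. dist x' c < d \<longrightarrow> dist (gamma_limit \<omega> x') (gamma_limit \<omega> c) < e"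
  proof (intro exI[of _ d] conjI ballI impI d(1))
    fix x' assume x': "x' \<in> {0..}" "dist x' c < d"
    then have "\<bar>gamma_limit \<omega> x' - gamma_limit \<omega> c\<bar> \<le> sqrt (2 * \<bar>x' - c\<bar>)"
      using c d by (intro gamma_limit_diff) (auto simp: dist_real_def)
    also have "\<dots> \<le> sqrt (2 * d)" using x' by (simp add: dist_real_def)
    finally show "dist (gamma_limit \<omega> x') (gamma_limit \<omega> c) < e" using d(3) e
      by (simp add: dist_real_def)
  qed
qed

text \<open>Equicontinuity reduces uniform convergence on \<open>[0,M]\<close> to convergence at the finitely many
  points \<open>i d\<close> of a grid.\<close>

lemma gamma_ratio_uniform:
  assumes e: "0 < e"
  shows "\<exists>h>0. \<forall>x c. 0 < x \<longrightarrow> x \<le> h \<longrightarrow> 0 \<le> c \<longrightarrow> c \<le> M \<longrightarrow> \<bar>gamma_fun \<omega> c x / x - gamma_limit \<omega> c\<bar> \<le> e"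
proof -
  obtain d where d: "d > 0" "d \<le> 1/2" "sqrt (2 * d) \<le> e / 3" using sqrt_small[of "e/3"] e by auto
  define N where "N = nat \<lceil>M / d\<rceil>"
  have "\<forall>\<^sub>F x in at_right 0. \<forall>i\<in>{..N}. dist (gamma_fun \<omega> (real i * d) x / x) (gamma_limit \<omega> (real i * d)) < e / 3"
    using gamma_limit d e by (intro eventually_ball_finite ballI tendstoD) auto
  then obtain b where b: "b > 0" "\<And>x i. 0 < x \<Longrightarrow> x < b \<Longrightarrow> i \<le> N \<Longrightarrow>
      \<bar>gamma_fun \<omega> (real i * d) x / x - gamma_limit \<omega> (real i * d)\<bar> < e / 3"
    unfolding eventually_at_right_field by (auto simp: dist_real_def)
  show ?thesis
  proof (intro exI[of _ "b/2"] conjI allI impI)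
    show "b / 2 > 0" using b by simp
    fix x c assume x: "0 < x" "x \<le> b / 2" and c: "0 \<le> c" "c \<le> M"
    define i where "i = nat \<lfloor>c / d\<rfloor>"
    have ri: "real i = of_int \<lfloor>c / d\<rfloor>" unfolding i_def using c d by simp
    have "real i \<le> c / d" "c / d < real i + 1" unfolding ri by linarith+
    then have *: "real i * d \<le> c" "c < real i * d + d" using d by (auto simp: field_simps)
    have "c / d \<le> M / d" using c d by (simp add: divide_right_mono)
    then have iN: "i \<le> N" unfolding i_def N_def by (intro nat_mono) linarith
    have near: "\<bar>c - real i * d\<bar> \<le> 1 / 2" "\<bar>c - real i * d\<bar> \<le> d" using * d by auto
    have s: "sqrt (2 * \<bar>c - real i * d\<bar>) \<le> e / 3"
      using near d by (intro order_trans[OF _ d(3)]) auto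
    have "\<bar>gamma_fun \<omega> c x / x - gamma_fun \<omega> (real i * d) x / x\<bar> \<le> e / 3"
      using gamma_ratio_diff[of c "real i * d" x] near c x d s by (simp del: real_sqrt_le_iff)
    moreover have "\<bar>gamma_limit \<omega> c - gamma_limit \<omega> (real i * d)\<bar> \<le> e / 3"
      using gamma_limit_diff[of c "real i * d"] near c x d s by (simp del: real_sqrt_le_iff)
    moreover have "\<bar>gamma_fun \<omega> (real i * d) x / x - gamma_limit \<omega> (real i * d)\<bar> < e / 3"
      using b(2)[of x i] x iN b(1) by simp
    ultimately show "\<bar>gamma_fun \<omega> c x / x - gamma_limit \<omega> c\<bar> \<le> e" by linarith
  qed
qed

end

text \<open>A regular modulus together with a continuous nonnegative weight on \<open>[0,1]\<close>.\<close>

locale weighted_modulus = regular_modulus +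
  fixes P :: "real \<Rightarrow> real"
  assumes P_cont: "continuous_on {0..1} P" and P_nonneg: "\<And>t. t \<in> {0..1} \<Longrightarrow> 0 \<le> P t"
begin

lemma gamma_limit_P_cont: "continuous_on {0..1} (\<lambda>t. gamma_limit \<omega> (P t))"
  by (rule continuous_on_compose2[OF gamma_limit_continuous P_cont]) (use P_nonneg in auto)

text \<open>The value of the limit \<open>B\<close>. The sets of \<open>n\<close> knots constructed for the
  upper bound have density close to \<open>n l(P(t))/B\<close>.\<close>

definition total_density :: real where
  "total_density = integral {0..1} (\<lambda>t. gamma_limit \<omega> (P t))"

lemma P_bounded: obtains M where "M > 0" "\<And>t. t \<in> {0..1} \<Longrightarrow> P t \<le> M"
proof -
  have "bounded (P ` {0..1})" by (intro compact_imp_bounded compact_continuous_image P_cont) auto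
  then obtain M where "M > 0" "\<And>t. t \<in> {0..1} \<Longrightarrow> \<bar>P t\<bar> \<le> M"
    unfolding bounded_pos by auto
  then show ?thesis by (intro that[of M]) (auto simp: abs_le_iff)
qed

lemma gamma_P_uniform:
  assumes "0 < e"
  obtains h where "h > 0" "\<And>x t. 0 < x \<Longrightarrow> x \<le> h \<Longrightarrow> t \<in> {0..1} \<Longrightarrow>
    \<bar>gamma_fun \<omega> (P t) x - gamma_limit \<omega> (P t) * x\<bar> \<le> e * x"
proof -
  obtain M where M: "\<And>t. t \<in> {0..1} \<Longrightarrow> P t \<le> M" using P_bounded by blast
  from gamma_ratio_uniform[OF assms, of M] obtain h where
    h: "h > 0" "\<And>x c. 0 < x \<Longrightarrow> x \<le> h \<Longrightarrow> 0 \<le> c \<Longrightarrow> c \<le> M \<Longrightarrow> \<bar>gamma_fun \<omega> c x / x - gamma_limit \<omega> c\<bar> \<le> e"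
    by blast
  show ?thesis
  proof (rule that[OF h(1)])
    fix x t :: real assume x: "0 < x" "x \<le> h" "t \<in> {0..1}"
    have "gamma_fun \<omega> (P t) x - gamma_limit \<omega> (P t) * x
      = (gamma_fun \<omega> (P t) x / x - gamma_limit \<omega> (P t)) * x"
      using x by (simp add: field_simps)
    then have "\<bar>gamma_fun \<omega> (P t) x - gamma_limit \<omega> (P t) * x\<bar>
      = \<bar>gamma_fun \<omega> (P t) x / x - gamma_limit \<omega> (P t)\<bar> * x"
      using x by (simp add: abs_mult)
    also have "\<dots> \<le> e * x" using h(2)[of x "P t"] x M P_nonneg by (intro mult_right_mono) auto
    finally show "\<bar>gamma_fun \<omega> (P t) x - gamma_limit \<omega> (P t) * x\<bar> \<le> e * x" .
  qed
qed

lemma B_seq_tendsto: "B_seq P \<omega> \<longlonglongrightarrow> total_density"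
proof (rule LIMSEQ_I)
  fix r :: real assume r: "r > 0"
  obtain h where h: "h > 0" "\<And>x t. 0 < x \<Longrightarrow> x \<le> h \<Longrightarrow> t \<in> {0..1} \<Longrightarrow>
    \<bar>gamma_fun \<omega> (P t) x - gamma_limit \<omega> (P t) * x\<bar> \<le> r / 3 * x"
    using gamma_P_uniform[of "r/3"] r by auto
  obtain \<eta> where \<eta>: "\<eta> > 0" "\<And>x y. x \<in> {0..1} \<Longrightarrow> y \<in> {0..1} \<Longrightarrow> \<bar>x - y\<bar> \<le> \<eta> \<Longrightarrow>
      \<bar>gamma_limit \<omega> (P x) - gamma_limit \<omega> (P y)\<bar> \<le> r / 3"
    using uniformly_continuous_unit_interval[OF gamma_limit_P_cont, of "r/3"] r by auto
  obtain n0 where n0: "n0 > 0" "1 / real n0 < min h \<eta>"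
    using h(1) \<eta>(1) by (metis inverse_eq_divide min_less_iff_conj reals_Archimedean zero_less_Suc)
  show "\<exists>n0. \<forall>n\<ge>n0. norm (B_seq P \<omega> n - total_density) < r"
  proof (intro exI[of _ n0] allI impI)
    fix n assume "n \<ge> n0"
    then have n: "n > 0" "1 / real n \<le> 1 / real n0" using n0(1) by (auto simp: frac_le)
    define \<xi> where "\<xi> k = (2 * real k - 1) / (2 * real n)" for k :: nat
    have \<xi>: "\<xi> k \<in> {real (k - 1) / real n..real k / real n}" if "k \<in> {1..n}" for k
      using that n(1) unfolding \<xi>_def by (auto simp: field_simps of_nat_diff)
    have tp: "tagged_partition n (\<lambda>k. real k / real n) \<xi>" "mesh n (\<lambda>k. real k / real n)
      = 1 / real n"
      using uniform_tagged_partition[of n \<xi>] n(1) \<xi> by auto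
    have sum1: "\<bar>(\<Sum>k=1..n. (real k / real n - real (k - 1) / real n) * gamma_limit \<omega> (P (\<xi> k))) - total_density\<bar> \<le> r / 3"
      unfolding total_density_def
      by (rule riemann_sum_error[OF tp(1) _ gamma_limit_P_cont \<eta>(2)]) (use tp(2) n n0 in auto)
    have len: "real k / real n - real (k - 1) / real n = 1 / real n" if "k \<in> {1..n}" for k
      using that n(1) by (simp add: field_simps of_nat_diff)
    have "\<bar>B_seq P \<omega> n - (\<Sum>k=1..n. (real k / real n - real (k - 1) / real n) * gamma_limit \<omega> (P (\<xi> k)))\<bar>
        \<le> (\<Sum>k=1..n. r / 3 * (1 / real n))"
      unfolding B_seq_def gamma_fun_def[symmetric] \<xi>_def[symmetric] sum_subtractf[symmetric]
    proof (rule order_trans[OF sum_abs sum_mono])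
      fix k assume k: "k \<in> {1..n}"
      then show "\<bar>gamma_fun \<omega> (P (\<xi> k)) (1 / real n) - (real k / real n - real (k - 1) / real n) * gamma_limit \<omega> (P (\<xi> k))\<bar>
          \<le> r / 3 * (1 / real n)"
        using h(2)[of "1 / real n" "\<xi> k"] n n0 tagged_partitionD(7)[OF tp(1) k] len[OF k]
        by (simp add: mult.commute)
    qed
    also have "\<dots> = r / 3" using n by simp
    finally show "norm (B_seq P \<omega> n - total_density) < r"
      unfolding real_norm_def using sum1 r by linarith
  qed
qed

lemma total_density_pos:
  assumes "\<exists>t\<in>{0..1}. 0 < P t"
  shows "0 < total_density"
proof -
  obtain t where t: "t \<in> {0..1}" "0 < P t" using assms by auto
  have nn: "gamma_limit \<omega> (P s) \<ge> 0" if "s \<in> {0..1}" for s using gamma_limit_nonneg P_nonneg that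
    by auto
  have "total_density \<noteq> 0"
  proof
    assume "total_density = 0"
    then have "gamma_limit \<omega> (P t) = 0"
      using integral_eq_0_iff[OF gamma_limit_P_cont, of ] nn t unfolding total_density_def by auto
    then show False using gamma_limit_ge[of "P t"] t by simp
  qed
  moreover have "total_density \<ge> 0" unfolding total_density_def
    using nn by (intro integral_nonneg integrable_continuous_interval gamma_limit_P_cont) auto
  ultimately show ?thesis by simp
qed

end

section \<open>The Hausdorff distance and support functions\<close>

lemma nonempty_compactsD:
  assumes "A \<in> nonempty_compacts"
  shows "compact A" "A \<noteq> {}" "closed A" "bounded A"
  using assms compact_imp_closed compact_imp_bounded unfolding nonempty_compacts_def by auto

lemma nonempty_convex_compactsD:
  assumes "A \<in> nonempty_convex_compacts"
  shows "A \<in> nonempty_compacts" "convex A"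
  using assms unfolding nonempty_convex_compacts_def by auto

lemma nonempty_compacts_scale: "A \<in> nonempty_compacts \<Longrightarrow> scale_set c A \<in> nonempty_compacts"
  unfolding nonempty_compacts_def scale_set_def by (auto intro: compact_scaling)

lemma compact_Minkowski_sum:
  fixes A B :: "'a::real_normed_vector set"
  assumes "compact A" "compact B"
  shows "compact (A + B)"
proof -
  have "A + B = {x + y |x y. x \<in> A \<and> y \<in> B}" by (auto simp: set_plus_def)
  then show ?thesis using compact_sums[OF assms] by simp
qed

lemma nonempty_compacts_sum:
  assumes "\<And>i. i \<in> I \<Longrightarrow> A i \<in> nonempty_compacts"
  shows "(\<Sum>i\<in>I. A i) \<in> nonempty_compacts"
  using assms
proof (induction I rule: infinite_finite_induct)
  case (insert x F)
  then show ?case 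
    by (auto simp: nonempty_compacts_def intro!: compact_Minkowski_sum)
qed (auto simp: nonempty_compacts_def set_zero)

lemma nonempty_convex_compacts_combination:
  assumes "\<And>i. i \<in> I \<Longrightarrow> A i \<in> nonempty_compacts"
  shows "(\<Sum>i\<in>I. scale_set (c i) (convex hull (A i))) \<in> nonempty_convex_compacts"
proof -
  have "convex hull (A i) \<in> nonempty_compacts" if "i \<in> I" for i
    using assms[OF that] unfolding nonempty_compacts_def by (auto intro: compact_convex_hull)
  then have "(\<Sum>i\<in>I. scale_set (c i) (convex hull (A i))) \<in> nonempty_compacts"
    by (intro nonempty_compacts_sum nonempty_compacts_scale) auto
  moreover have "convex (\<Sum>i\<in>I. scale_set (c i) (convex hull (A i)))"
    by (intro convex_set_sum) (auto simp: scale_set_def intro: convex_scaling)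
  ultimately show ?thesis by (simp add: nonempty_convex_compacts_def)
qed

lemma hausdorff_excess_le_iff:
  assumes "A \<in> nonempty_compacts"
  shows "hausdorff_excess A B \<le> e \<longleftrightarrow> (\<forall>a\<in>A. infdist a B \<le> e)"
proof -
  have "bdd_above ((\<lambda>a. infdist a B) ` A)"
    using nonempty_compactsD[OF assms]
    by (intro bounded_imp_bdd_above compact_imp_bounded compact_continuous_image continuous_intros) auto
  then show ?thesis unfolding hausdorff_excess_def
    using nonempty_compactsD(2)[OF assms] by (subst cSUP_le_iff) auto
qed

lemma infdist_le_hausdorff_dist:
  assumes "A \<in> nonempty_compacts" "a \<in> A"
  shows "infdist a B \<le> hausdorff_dist A B"
  using hausdorff_excess_le_iff[OF assms(1), of B "hausdorff_excess A B"] assms(2)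
  unfolding hausdorff_dist_def by fastforce

lemma hausdorff_dist_commute: "hausdorff_dist A B = hausdorff_dist B A"
  unfolding hausdorff_dist_def by simp

lemma hausdorff_dist_leI:
  assumes "A \<in> nonempty_compacts" "B \<in> nonempty_compacts"
    and "\<And>a. a \<in> A \<Longrightarrow> infdist a B \<le> e" "\<And>b. b \<in> B \<Longrightarrow> infdist b A \<le> e"
  shows "hausdorff_dist A B \<le> e"
  unfolding hausdorff_dist_def using hausdorff_excess_le_iff assms by auto

lemma hausdorff_dist_nonneg:
  assumes "A \<in> nonempty_compacts"
  shows "0 \<le> hausdorff_dist A B"
proof -
  obtain a where "a \<in> A" using nonempty_compactsD[OF assms] by auto
  then show ?thesis using infdist_le_hausdorff_dist[OF assms, of a B] infdist_nonneg[of a B] by simp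
qed

lemma nearest_point:
  assumes "A \<in> nonempty_compacts" "B \<in> nonempty_compacts" "a \<in> A"
  obtains b where "b \<in> B" "dist a b \<le> hausdorff_dist A B"
  using infdist_attains_inf[of B a] infdist_le_hausdorff_dist[OF assms(1,3), of B] 
    nonempty_compactsD[OF assms(2)] by metis

lemma hausdorff_dist_triangle:
  fixes A B C :: "'a::euclidean_space set"
  assumes "A \<in> nonempty_compacts" "B \<in> nonempty_compacts" "C \<in> nonempty_compacts"
  shows "hausdorff_dist A C \<le> hausdorff_dist A B + hausdorff_dist B C"
proof -
  have "infdist x Z \<le> hausdorff_dist X Y + hausdorff_dist Y Z"
    if X: "X \<in> nonempty_compacts" "x \<in> X" and Y: "Y \<in> nonempty_compacts" for x and X Y Z :: "'a set"
  proof -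
    obtain y where y: "y \<in> Y" "dist x y \<le> hausdorff_dist X Y" using nearest_point X Y by blast
    show ?thesis
      using infdist_triangle[of x Z y] infdist_le_hausdorff_dist[OF Y y(1), of Z] y(2) by simp
  qed
  note key = this
  show ?thesis
  proof (rule hausdorff_dist_leI)
    show "infdist a C \<le> hausdorff_dist A B + hausdorff_dist B C" if "a \<in> A" for a
      using key[where X = A and Y = B] that assms by blast
    have "infdist c A \<le> hausdorff_dist C B + hausdorff_dist B A" if "c \<in> C" for c
      using key[where X = C and Y = B] that assms by blast
    then show "infdist c A \<le> hausdorff_dist A B + hausdorff_dist B C" if "c \<in> C" for c
      using that hausdorff_dist_commute[of A B] hausdorff_dist_commute[of B C] by fastforce
  qed (use assms in auto)
qed

lemma hausdorff_dist_zero_imp_eq: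
  fixes A B :: "'a::euclidean_space set"
  assumes "A \<in> nonempty_compacts" "B \<in> nonempty_compacts" "hausdorff_dist A B \<le> 0"
  shows "A = B"
proof -
  have "X \<subseteq> Y" if X: "X \<in> nonempty_compacts" and Y: "Y \<in> nonempty_compacts"
    and XY: "hausdorff_dist X Y \<le> 0" for X Y :: "'a set"
  proof
    fix x assume "x \<in> X"
    then obtain y where "y \<in> Y" "dist x y \<le> 0"
      using nearest_point[OF X Y] XY by (metis order_trans)
    then show "x \<in> Y" by simp
  qed
  then show ?thesis using assms hausdorff_dist_commute[of A B] by (metis subset_antisym)
qed

text \<open>The support function of \<open>A\<close>, used only for nonempty compact \<open>A\<close>, where the supremum is
  attained.\<close>

definition support :: "'a::euclidean_space set \<Rightarrow> 'a \<Rightarrow> real" where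
  "support A u = (SUP a\<in>A. u \<bullet> a)"

lemma support_attained:
  assumes "A \<in> nonempty_compacts"
  obtains a where "a \<in> A" "support A u = u \<bullet> a"
proof -
  have "compact A" "A \<noteq> {}" using nonempty_compactsD[OF assms] by auto
  moreover have "continuous_on A (\<lambda>a. u \<bullet> a)" by (intro continuous_intros)
  ultimately obtain a where a: "a \<in> A" "\<forall>y\<in>A. u \<bullet> y \<le> u \<bullet> a"
    using continuous_attains_sup by blast
  then have "support A u = u \<bullet> a"
    unfolding support_def by (intro cSup_eq_maximum) auto
  then show ?thesis using a that by auto
qed

lemma support_upper:
  assumes "A \<in> nonempty_compacts" "a \<in> A"
  shows "u \<bullet> a \<le> support A u"
  unfolding support_def
proof (rule cSUP_upper[OF assms(2)])
  show "bdd_above ((\<bullet>) u ` A)"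
    using nonempty_compactsD(1)[OF assms(1)]
    by (intro bounded_imp_bdd_above compact_imp_bounded compact_continuous_image continuous_intros)
qed

lemma support_eqI:
  assumes "\<And>a. a \<in> A \<Longrightarrow> u \<bullet> a \<le> s" "b \<in> A" "s \<le> u \<bullet> b"
  shows "support A u = s"
  unfolding support_def by (rule cSup_eq_maximum) (use assms in \<open>auto intro: antisym simp: image_iff\<close>)

lemma support_scale:
  assumes "A \<in> nonempty_compacts" "0 \<le> c"
  shows "support (scale_set c A) u = c * support A u"
proof -
  obtain a where a: "a \<in> A" "support A u = u \<bullet> a" using support_attained[OF assms(1)] by blast
  have "u \<bullet> x \<le> c * support A u" if "x \<in> scale_set c A" for x
    using that support_upper[OF assms(1), of _ u] assms(2)
    by (auto simp: scale_set_def intro!: mult_left_mono)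
  then show ?thesis
    by (rule support_eqI[of _ _ _ "c *\<^sub>R a"]) (use a in \<open>auto simp: scale_set_def\<close>)
qed

lemma support_plus:
  assumes "A \<in> nonempty_compacts" "B \<in> nonempty_compacts"
  shows "support (A + B) u = support A u + support B u"
proof -
  obtain a where a: "a \<in> A" "support A u = u \<bullet> a" using support_attained[OF assms(1)] by blast
  obtain b where b: "b \<in> B" "support B u = u \<bullet> b" using support_attained[OF assms(2)] by blast
  have "u \<bullet> x \<le> support A u + support B u" if "x \<in> A + B" for x
    using that support_upper[OF assms(1), of _ u] support_upper[OF assms(2), of _ u]
    by (auto simp: set_plus_def inner_add_right intro!: add_mono)
  then show ?thesis
    by (rule support_eqI[of _ _ _ "a + b"]) (use a b in \<open>auto simp: inner_add_right\<close>)
qed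

lemma support_sum:
  assumes "finite I" "\<And>i. i \<in> I \<Longrightarrow> A i \<in> nonempty_compacts"
  shows "support (\<Sum>i\<in>I. A i) u = (\<Sum>i\<in>I. support (A i) u)"
  using assms
proof (induction I)
  case empty
  show ?case by (simp add: support_def set_zero)
next
  case (insert x F)
  then show ?case using nonempty_compacts_sum[of F A] by (simp add: support_plus)
qed

lemma support_convex_hull:
  assumes "A \<in> nonempty_compacts"
  shows "support (convex hull A) u = support A u"
proof -
  obtain a where a: "a \<in> A" "support A u = u \<bullet> a" using support_attained[OF assms(1)] by blast
  have "convex hull A \<subseteq> {x. u \<bullet> x \<le> support A u}"
    using support_upper[OF assms] by (intro hull_minimal convex_halfspace_le) auto
  then show ?thesis
    using a hull_subset[of A convex] by (intro support_eqI[of _ _ _ a]) auto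
qed

lemma support_diff_le:
  fixes A B :: "'a::euclidean_space set"
  assumes "A \<in> nonempty_compacts" "B \<in> nonempty_compacts"
  shows "\<bar>support A u - support B u\<bar> \<le> hausdorff_dist A B * norm u"
proof -
  have *: "support X u \<le> support Y u + hausdorff_dist X Y * norm u"
    if X: "X \<in> nonempty_compacts" and Y: "Y \<in> nonempty_compacts" for X Y :: "'a set"
  proof -
    obtain x where x: "x \<in> X" "support X u = u \<bullet> x" using support_attained[OF X] by blast
    obtain y where y: "y \<in> Y" "dist x y \<le> hausdorff_dist X Y" using nearest_point[OF X Y x(1)]
      by blast
    have "u \<bullet> x = u \<bullet> y + u \<bullet> (x - y)" by (simp add: inner_diff_right)
    also have "\<dots> \<le> support Y u + norm u * norm (x - y)"
      using support_upper[OF Y y(1)] norm_cauchy_schwarz[of u "x - y"] by (intro add_mono) auto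
    also have "\<dots> \<le> support Y u + norm u * hausdorff_dist X Y"
      using y(2) by (intro add_left_mono mult_left_mono) (auto simp: dist_norm)
    finally show ?thesis using x by (simp add: mult.commute)
  qed
  show ?thesis using *[OF assms] *[OF assms(2,1)] hausdorff_dist_commute[of A B]
    by (simp add: abs_le_iff)
qed

text \<open>The nearest point \<open>b\<close> of the convex set \<open>B\<close> maximizes the inner product with \<open>u = a - b\<close>
  over \<open>B\<close>, so the hypothesis for this single \<open>u\<close> gives \<open>\<parallel>u\<parallel>\<^sup>2 \<le> e \<parallel>u\<parallel>\<close>.\<close>

lemma infdist_le_support:
  assumes A: "A \<in> nonempty_compacts" and B: "B \<in> nonempty_convex_compacts" and a: "a \<in> A"
    and e: "0 \<le> e" and le: "\<And>u. support A u \<le> support B u + e * norm u"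
  shows "infdist a B \<le> e"
proof -
  note B' = nonempty_convex_compactsD[OF B] and B''
    = nonempty_compactsD[OF nonempty_convex_compactsD(1)[OF B]]
  define b where "b = closest_point B a"
  define u where "u = a - b"
  have b: "b \<in> B" unfolding b_def using closest_point_in_set B'' by blast
  have "u \<bullet> (y - b) \<le> 0" if "y \<in> B" for y
    unfolding u_def b_def using closest_point_dot[OF B'(2) B''(3) that] .
  then have "support B u = u \<bullet> b"
    by (intro support_eqI[of _ _ _ b] b) (auto simp: inner_diff_right)
  then have "u \<bullet> a \<le> u \<bullet> b + e * norm u"
    using le[of u] support_upper[OF A a, of u] by simp
  then have "u \<bullet> u \<le> e * norm u"
    by (simp add: u_def inner_diff_right)
  then have "norm u * norm u \<le> e * norm u"
    by (simp add: dot_square_norm power2_eq_square)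
  then have "dist a b \<le> e"
    using e by (cases "u = 0") (auto simp: u_def dist_norm)
  then show ?thesis using infdist_le[OF b, of a] by simp
qed

lemma hausdorff_dist_le_support:
  assumes A: "A \<in> nonempty_convex_compacts" and B: "B \<in> nonempty_convex_compacts"
    and e: "0 \<le> e" and le: "\<And>u. \<bar>support A u - support B u\<bar> \<le> e * norm u"
  shows "hausdorff_dist A B \<le> e"
proof (rule hausdorff_dist_leI)
  show "infdist a B \<le> e" if "a \<in> A" for a
    by (rule infdist_le_support[OF nonempty_convex_compactsD(1)[OF A] B that e])
      (use le in \<open>simp add: abs_le_iff algebra_simps\<close>)
  show "infdist b A \<le> e" if "b \<in> B" for b
    by (rule infdist_le_support[OF nonempty_convex_compactsD(1)[OF B] A that e])
      (use le in \<open>simp add: abs_le_iff algebra_simps\<close>)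
qed (use A B nonempty_convex_compactsD in auto)

text \<open>A form of the Shapley-Folkman theorem with a bound independent of the dimension. The
  points are chosen greedily: as \<open>y\<^sub>k\<close> lies in the convex hull of \<open>A\<^sub>k\<close>, some \<open>a\<^sub>k \<in> A\<^sub>k\<close> is
  such that \<open>a\<^sub>k - y\<^sub>k\<close> makes a nonacute angle with the error \<open>S\<close> accumulated so far, that is,
  \<open>S \<bullet> (a\<^sub>k - y\<^sub>k) \<le> 0\<close>, and the squared errors then add up.\<close>

lemma Shapley_Folkman_selection:
  fixes A :: "nat \<Rightarrow> 'a::euclidean_space set"
  assumes h: "\<And>i. i \<in> {1..N} \<Longrightarrow> 0 \<le> h i"
    and y: "\<And>i. i \<in> {1..N} \<Longrightarrow> y i \<in> convex hull (A i)"
    and D: "\<And>i. i \<in> {1..N} \<Longrightarrow> A i \<subseteq> cball 0 D"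
  shows "\<exists>a. (\<forall>i\<in>{1..N}. a i \<in> A i) \<and>
    (norm (\<Sum>i=1..N. h i *\<^sub>R (a i - y i)))\<^sup>2 \<le> (\<Sum>i=1..N. (h i)\<^sup>2 * (2 * D)\<^sup>2)"
  using h y D
proof (induction N)
  case 0
  show ?case by simp
next
  case (Suc N)
  obtain a where a: "\<forall>i\<in>{1..N}. a i \<in> A i"
    "(norm (\<Sum>i=1..N. h i *\<^sub>R (a i - y i)))\<^sup>2 \<le> (\<Sum>i=1..N. (h i)\<^sup>2 * (2 * D)\<^sup>2)"
    using Suc.IH Suc.prems by auto
  define S where "S = (\<Sum>i=1..N. h i *\<^sub>R (a i - y i))"
  let ?k = "Suc N"
  have hk: "0 \<le> h ?k" and yk: "y ?k \<in> convex hull (A ?k)" and Dk: "A ?k \<subseteq> cball 0 D"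
    using Suc.prems by auto
  have "\<exists>b\<in>A ?k. S \<bullet> (b - y ?k) \<le> 0"
  proof (rule ccontr)
    assume "\<not> ?thesis"
    then have "A ?k \<subseteq> {x. S \<bullet> x > S \<bullet> y ?k}" by (auto simp: inner_diff_right not_le)
    then have "convex hull (A ?k) \<subseteq> {x. S \<bullet> x > S \<bullet> y ?k}"
      by (intro hull_minimal convex_halfspace_gt)
    then show False using yk by auto
  qed
  then obtain b where b: "b \<in> A ?k" "S \<bullet> (b - y ?k) \<le> 0" by auto
  have "convex hull (A ?k) \<subseteq> cball 0 D" using Dk by (intro hull_minimal convex_cball)
  then have "norm (b - y ?k) \<le> 2 * D"
    using b(1) Dk yk norm_triangle_ineq4[of b "y ?k"] by (force simp: subset_iff)
  then have nb: "(norm (b - y ?k))\<^sup>2 \<le> (2 * D)\<^sup>2" by (intro power_mono) auto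
  have "(norm (S + c *\<^sub>R d))\<^sup>2 = (norm S)\<^sup>2 + 2 * c * (S \<bullet> d) + c\<^sup>2 * (norm d)\<^sup>2" for c d
    unfolding power2_norm_eq_inner
    by (simp add: inner_add_left inner_add_right inner_commute power2_eq_square)
  then have "(norm (S + h ?k *\<^sub>R (b - y ?k)))\<^sup>2
      = (norm S)\<^sup>2 + 2 * h ?k * (S \<bullet> (b - y ?k)) + (h ?k)\<^sup>2 * (norm (b - y ?k))\<^sup>2" .
  also have "\<dots> \<le> (\<Sum>i=1..N. (h i)\<^sup>2 * (2 * D)\<^sup>2) + 0 + (h ?k)\<^sup>2 * (2 * D)\<^sup>2"
    using a(2) b(2) hk nb unfolding S_def
    by (intro add_mono mult_left_mono) (auto intro: mult_nonneg_nonpos)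
  finally have *: "(norm (S + h ?k *\<^sub>R (b - y ?k)))\<^sup>2 \<le> (\<Sum>i=1..?k. (h i)\<^sup>2 * (2 * D)\<^sup>2)" by simp
  define a' where "a' = a(?k := b)"
  have "(\<Sum>i=1..?k. h i *\<^sub>R (a' i - y i)) = S + h ?k *\<^sub>R (b - y ?k)"
    unfolding S_def a'_def by simp
  moreover have "\<forall>i\<in>{1..?k}. a' i \<in> A i" using a(1) b(1) unfolding a'_def by auto
  ultimately show ?case using * by (intro exI[of _ a']) simp
qed

text \<open>Riemann-Minkowski sums of \<open>g\<close> and of its convex hull differ by an amount that vanishes
  with the mesh.\<close>

lemma infdist_Minkowski_sum_hull:
  fixes g :: "real \<Rightarrow> 'a::euclidean_space set"
  assumes tp: "tagged_partition N t \<xi>" 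
    and D: "\<And>x. x \<in> {0..1} \<Longrightarrow> g x \<subseteq> cball 0 D"
    and v: "v \<in> riemann_minkowski_sum (\<lambda>x. convex hull (g x)) N t \<xi>"
  shows "infdist v (riemann_minkowski_sum g N t \<xi>) \<le> 2 * \<bar>D\<bar> * sqrt (mesh N t)"
proof -
  note T = tagged_partitionD[OF tp]
  obtain s where s: "v = (\<Sum>i=1..N. s i)" "\<forall>i\<in>{1..N}. s i \<in> scale_set (t i - t (i - 1)) (convex hull (g (\<xi> i)))"
    using v unfolding riemann_minkowski_sum_def by (auto simp: set_sum_alt)
  then have "\<forall>i\<in>{1..N}. \<exists>y. s i = (t i - t (i - 1)) *\<^sub>R y \<and> y \<in> convex hull (g (\<xi> i))"
    unfolding scale_set_def by blast
  then obtain y where y: "\<And>i. i \<in> {1..N} \<Longrightarrow> s i = (t i - t (i - 1)) *\<^sub>R y i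
    \<and> y i \<in> convex hull (g (\<xi> i))"
    by (metis (no_types, lifting) bchoice)
  define h where "h i = t i - t (i - 1)" for i
  have "\<exists>a. (\<forall>i\<in>{1..N}. a i \<in> g (\<xi> i)) \<and>
    (norm (\<Sum>i=1..N. h i *\<^sub>R (a i - y i)))\<^sup>2 \<le> (\<Sum>i=1..N. (h i)\<^sup>2 * (2 * D)\<^sup>2)"
    using y D T(7) T(4) unfolding h_def
      by (intro Shapley_Folkman_selection) (auto intro: less_imp_le)
  then obtain a where a: "\<forall>i\<in>{1..N}. a i \<in> g (\<xi> i)"
    "(norm (\<Sum>i=1..N. h i *\<^sub>R (a i - y i)))\<^sup>2 \<le> (\<Sum>i=1..N. (h i)\<^sup>2 * (2 * D)\<^sup>2)" by auto
  define w where "w = (\<Sum>i=1..N. h i *\<^sub>R a i)"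
  have w: "w \<in> riemann_minkowski_sum g N t \<xi>"
    unfolding riemann_minkowski_sum_def w_def h_def using a(1)
    by (auto simp: set_sum_alt scale_set_def intro!: exI[of _ "\<lambda>i. (t i - t (i - 1)) *\<^sub>R a i"])
  have "v = (\<Sum>i=1..N. h i *\<^sub>R y i)" unfolding s(1) h_def using y by (intro sum.cong) auto
  then have "w - v = (\<Sum>i=1..N. h i *\<^sub>R (a i - y i))"
    unfolding w_def by (simp add: sum_subtractf scaleR_diff_right)
  then have "(norm (w - v))\<^sup>2 \<le> (\<Sum>i=1..N. (h i)\<^sup>2 * (2 * D)\<^sup>2)" using a(2) by simp
  also have "\<dots> \<le> (\<Sum>i=1..N. (mesh N t * (2 * D)\<^sup>2) * h i)"
  proof (rule sum_mono)
    fix i assume i: "i \<in> {1..N}"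
    have "h i * h i \<le> mesh N t * h i"
      using mesh_bound[OF i, of t] T(4)[OF i] unfolding h_def by (intro mult_right_mono) auto
    then have "(h i * h i) * (2 * D)\<^sup>2 \<le> (mesh N t * h i) * (2 * D)\<^sup>2"
      by (rule mult_right_mono) simp
    then show "(h i)\<^sup>2 * (2 * D)\<^sup>2 \<le> (mesh N t * (2 * D)\<^sup>2) * h i"
      by (simp add: power2_eq_square mult_ac)
  qed
  also have "\<dots> = mesh N t * (2 * D)\<^sup>2"
    unfolding sum_distrib_left[symmetric] h_def sum_partition_lengths by (simp add: T)
  finally have "norm (w - v) \<le> sqrt (mesh N t * (2 * D)\<^sup>2)" by (rule real_le_rsqrt)
  also have "\<dots> = 2 * \<bar>D\<bar> * sqrt (mesh N t)" by (simp add: real_sqrt_mult abs_mult)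
  finally show ?thesis using infdist_le2[OF w, of v] by (simp add: dist_norm norm_minus_commute)
qed

lemma riemann_minkowski_sum_hull:
  assumes "tagged_partition N t \<xi>" "g \<in> {0..1} \<rightarrow> nonempty_compacts"
  shows "riemann_minkowski_sum g N t \<xi> \<in> nonempty_compacts"
    "riemann_minkowski_sum (\<lambda>x. convex hull (g x)) N t \<xi> \<in> nonempty_convex_compacts"
    "riemann_minkowski_sum g N t \<xi> \<subseteq> riemann_minkowski_sum (\<lambda>x. convex hull (g x)) N t \<xi>"
    "support (riemann_minkowski_sum (\<lambda>x. convex hull (g x)) N t \<xi>) u
      = (\<Sum>i=1..N. (t i - t (i - 1)) * support (g (\<xi> i)) u)"
proof -
  note T = tagged_partitionD[OF assms(1)]
  have g: "g (\<xi> i) \<in> nonempty_compacts" if "i \<in> {1..N}" for i using T(7)[OF that] assms(2) by auto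
  then have gc: "convex hull (g (\<xi> i)) \<in> nonempty_compacts" if "i \<in> {1..N}" for i
    using that unfolding nonempty_compacts_def by (auto intro: compact_convex_hull)
  show "riemann_minkowski_sum g N t \<xi> \<in> nonempty_compacts"
    unfolding riemann_minkowski_sum_def using g
      by (intro nonempty_compacts_sum nonempty_compacts_scale)
  show "riemann_minkowski_sum (\<lambda>x. convex hull (g x)) N t \<xi> \<in> nonempty_convex_compacts"
    unfolding riemann_minkowski_sum_def using g by (intro nonempty_convex_compacts_combination)
  show "riemann_minkowski_sum g N t \<xi> \<subseteq> riemann_minkowski_sum (\<lambda>x. convex hull (g x)) N t \<xi>"
  proof
    fix v assume "v \<in> riemann_minkowski_sum g N t \<xi>"
    then obtain s where s: "v = (\<Sum>i=1..N. s i)" "\<forall>i\<in>{1..N}. s i \<in> scale_set (t i - t (i - 1)) (g (\<xi> i))"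
      unfolding riemann_minkowski_sum_def by (auto simp: set_sum_alt)
    have "scale_set c (g x) \<subseteq> scale_set c (convex hull (g x))" for c x
      unfolding scale_set_def by (intro image_mono hull_subset)
    then show "v \<in> riemann_minkowski_sum (\<lambda>x. convex hull (g x)) N t \<xi>"
      unfolding riemann_minkowski_sum_def using s by (simp add: set_sum_alt) blast
  qed
  have "support (riemann_minkowski_sum (\<lambda>x. convex hull (g x)) N t \<xi>) u
      = (\<Sum>i=1..N. support (scale_set (t i - t (i - 1)) (convex hull (g (\<xi> i)))) u)"
    unfolding riemann_minkowski_sum_def using gc by (intro support_sum nonempty_compacts_scale) auto
  also have "\<dots> = (\<Sum>i=1..N. (t i - t (i - 1)) * support (g (\<xi> i)) u)"
    using gc g T(4) by (intro sum.cong) (auto simp: support_scale support_convex_hull less_imp_le)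
  finally show "support (riemann_minkowski_sum (\<lambda>x. convex hull (g x)) N t \<xi>) u
    = (\<Sum>i=1..N. (t i - t (i - 1)) * support (g (\<xi> i)) u)" .
qed

text \<open>A uniform limit \<open>H\<close> of support functions of bounded compact sets \<open>C\<^sub>n\<close> is again a support
  function. A maximizer of \<open>u \<bullet> v\<close> over the limit set arises as a limit point of maximizers over
  the sets \<open>C\<^sub>n\<close>.\<close>

lemma compact_limit_of_support:
  fixes C :: "nat \<Rightarrow> 'a::euclidean_space set" and H :: "'a \<Rightarrow> real"
  assumes C: "\<And>n. C n \<in> nonempty_compacts" and D: "\<And>n. C n \<subseteq> cball 0 D"
    and e: "e \<longlonglongrightarrow> 0" and approx: "\<And>n u. \<bar>support (C n) u - H u\<bar> \<le> e n * norm u"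
  shows "{v. \<forall>u. u \<bullet> v \<le> H u} \<in> nonempty_convex_compacts" (is "?I \<in> _")
    and "support {v. \<forall>u. u \<bullet> v \<le> H u} u = H u"
proof -
  have lim: "(\<lambda>n. support (C n) u) \<longlonglongrightarrow> H u" for u
  proof (rule LIM_zero_cancel, rule Lim_null_comparison)
    show "\<forall>\<^sub>F n in sequentially. norm (support (C n) u - H u) \<le> e n * norm u"
      using approx by simp
    show "(\<lambda>n. e n * norm u) \<longlonglongrightarrow> 0" using tendsto_mult_right[OF e, of "norm u"] by simp
  qed
  have attained: "\<exists>v\<in>?I. H u \<le> u \<bullet> v" for u
  proof -
    have "\<exists>c. \<forall>n. c n \<in> C n \<and> support (C n) u = u \<bullet> c n"
      using support_attained[OF C] by (intro choice) metis
    then obtain c where c: "\<And>n. c n \<in> C n" "\<And>n. support (C n) u = u \<bullet> c n" by auto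
    have "compact (cball (0::'a) D)" by simp
    moreover have "\<forall>n. c n \<in> cball 0 D" using c D by blast
    ultimately obtain v r where r: "strict_mono r" "(c \<circ> r) \<longlonglongrightarrow> v"
      unfolding compact_def by blast
    have sub: "(\<lambda>n. support (C (r n)) w) \<longlonglongrightarrow> H w" for w
      using LIMSEQ_subseq_LIMSEQ[OF lim r(1)] by (simp add: o_def)
    have cv: "(\<lambda>n. w \<bullet> c (r n)) \<longlonglongrightarrow> w \<bullet> v" for w
      using r(2) by (intro tendsto_intros) (simp add: o_def)
    have "w \<bullet> v \<le> H w" for w
      by (rule LIMSEQ_le[OF cv sub]) (use support_upper[OF C c(1)] in blast)
    moreover have "H u \<le> u \<bullet> v"
      using LIMSEQ_le[OF sub cv] c(2) by auto
    ultimately show ?thesis by auto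
  qed
  have I: "?I = (\<Inter>u. {v. u \<bullet> v \<le> H u})" by auto
  have "closed ?I" unfolding I by (intro closed_INT ballI closed_halfspace_le)
  moreover have "convex ?I" unfolding I by (intro convex_INT convex_halfspace_le)
  moreover have "bounded ?I"
  proof (rule bounded_subset[OF bounded_cball[of 0 D]], rule subsetI)
    fix v assume v: "v \<in> ?I"
    have "support (C n) v \<le> D * norm v" for n
    proof -
      obtain c where c: "c \<in> C n" "support (C n) v = v \<bullet> c" using support_attained[OF C] by blast
      have "v \<bullet> c \<le> norm v * norm c" by (rule norm_cauchy_schwarz)
      also have "\<dots> \<le> norm v * D" using c(1) D[of n] by (intro mult_left_mono) auto
      finally show ?thesis using c by (simp add: mult.commute)
    qed
    then have "H v \<le> D * norm v" by (intro LIMSEQ_le_const2[OF lim]) auto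
    moreover have "v \<bullet> v \<le> H v" using v by blast
    ultimately have "v \<bullet> v \<le> D * norm v" by simp
    then have "norm v * norm v \<le> D * norm v" by (simp add: dot_square_norm power2_eq_square)
    moreover have "0 \<le> D"
      using D[of 0] nonempty_compactsD(2)[OF C[of 0]] by (force dest: order_trans[OF norm_ge_zero])
    ultimately show "v \<in> cball 0 D" by (cases "v = 0") auto
  qed
  moreover have "?I \<noteq> {}" using attained by blast
  ultimately show "?I \<in> nonempty_convex_compacts"
    by (simp add: nonempty_convex_compacts_def nonempty_compacts_def compact_eq_bounded_closed)
  obtain v where "v \<in> ?I" "H u \<le> u \<bullet> v" using attained by blast
  then show "support ?I u = H u" by (intro support_eqI[of _ _ _ v]) auto
qed

section \<open>The Riemann-Minkowski integral\<close>

lemma half_divide_cancel: "(a::real) > 0 \<Longrightarrow> e / (2 * a) * a = e / 2"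
  by (simp add: field_simps)

lemma has_rm_integral_unique:
  assumes I: "has_rm_integral g I" and J: "has_rm_integral g J"
  shows "I = J"
proof (rule hausdorff_dist_zero_imp_eq)
  show IJ: "I \<in> nonempty_compacts" "J \<in> nonempty_compacts" using I J
    by (auto simp: has_rm_integral_def)
  show "hausdorff_dist I J \<le> 0"
  proof (rule field_le_epsilon)
    fix \<epsilon> :: real assume "\<epsilon> > 0"
    then have e: "\<epsilon> / 2 > 0" by simp
    obtain \<eta> where \<eta>: "\<eta> > 0" "\<And>N t \<xi>. tagged_partition N t \<xi> \<Longrightarrow> mesh N t < \<eta> \<Longrightarrow>
        hausdorff_dist (riemann_minkowski_sum g N t \<xi>) I < \<epsilon> / 2"
      using I e unfolding has_rm_integral_def by meson
    obtain \<theta> where \<theta>: "\<theta> > 0" "\<And>N t \<xi>. tagged_partition N t \<xi> \<Longrightarrow> mesh N t < \<theta> \<Longrightarrow>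
        hausdorff_dist (riemann_minkowski_sum g N t \<xi>) J < \<epsilon> / 2"
      using J e unfolding has_rm_integral_def by meson
    obtain N t \<xi> where tp: "tagged_partition N t \<xi>" and mesh: "mesh N t < min \<eta> \<theta>"
      using uniform_partition_exists[of "min \<eta> \<theta>"] \<eta> \<theta> by auto
    have S: "riemann_minkowski_sum g N t \<xi> \<in> nonempty_compacts"
      using riemann_minkowski_sum_hull(1)[OF tp] I unfolding has_rm_integral_def by blast
    have "hausdorff_dist I (riemann_minkowski_sum g N t \<xi>) < \<epsilon> / 2"
      using \<eta>(2)[OF tp] mesh hausdorff_dist_commute[of I] by simp
    moreover have "hausdorff_dist (riemann_minkowski_sum g N t \<xi>) J < \<epsilon> / 2"
      using \<theta>(2)[OF tp] mesh by simp
    ultimately show "hausdorff_dist I J \<le> 0 + \<epsilon>"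
      using hausdorff_dist_triangle[OF IJ(1) S IJ(2)] by simp
  qed
qed

text \<open>Existence of the integral for uniformly continuous set-valued functions, and its support
  function. The support functions of the convexified sums are real Riemann sums, which avoids
  comparing Minkowski sums over different partitions.\<close>

lemma has_rm_integral_support:
  fixes g :: "real \<Rightarrow> 'a::euclidean_space set"
  assumes g: "g \<in> {0..1} \<rightarrow> nonempty_compacts"
    and D: "\<And>x. x \<in> {0..1} \<Longrightarrow> g x \<subseteq> cball 0 D"
    and unif: "\<And>e. e > 0 \<Longrightarrow> \<exists>\<eta>>0. \<forall>s\<in>{0..1}. \<forall>t\<in>{0..1}. \<bar>s - t\<bar> \<le> \<eta> \<longrightarrow> hausdorff_dist (g s) (g t) \<le> e"
  shows "\<exists>I\<in>nonempty_convex_compacts. has_rm_integral g I \<and>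
    (\<forall>u. support I u = integral {0..1} (\<lambda>t. support (g t) u))"
proof -
  define H where "H u = integral {0..1} (\<lambda>t. support (g t) u)" for u
  let ?S = "riemann_minkowski_sum g"
  let ?C = "riemann_minkowski_sum (\<lambda>x. convex hull (g x))"
  have gt: "g t \<in> nonempty_compacts" if "t \<in> {0..1}" for t using g that by auto
  have diff: "\<bar>support (g s) u - support (g t) u\<bar> \<le> e * norm u"
    if "s \<in> {0..1}" "t \<in> {0..1}" "hausdorff_dist (g s) (g t) \<le> e" for s t e u
    using support_diff_le[OF gt gt, of s t u] that mult_right_mono[OF that(3), of "norm u"] by simp
  have cont: "continuous_on {0..1} (\<lambda>t. support (g t) u)" for u
    unfolding continuous_on_iff
  proof (intro ballI allI impI)
    fix t e :: real assume t: "t \<in> {0..1}" and e: "e > 0"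
    define e' where "e' = e / (2 * (norm u + 1))"
    have u: "norm u + 1 > 0" by (simp add: add_nonneg_pos)
    have "e' > 0" using e u unfolding e'_def by simp
    then obtain \<eta> where \<eta>: "\<eta> > 0" "\<forall>s\<in>{0..1}. \<forall>t\<in>{0..1}. \<bar>s - t\<bar> \<le> \<eta> \<longrightarrow> hausdorff_dist (g s) (g t)
      \<le> e'"
      using unif by blast
    have "e' * norm u \<le> e' * (norm u + 1)" using \<open>e' > 0\<close> by simp
    also have "\<dots> = e / 2" using half_divide_cancel[OF u] unfolding e'_def .
    finally have small: "e' * norm u < e" using e by simp
    show "\<exists>d>0. \<forall>x'\<in>{0..1}. dist x' t < d \<longrightarrow> dist (support (g x') u) (support (g t) u) < e"
    proof (intro exI[of _ \<eta>] conjI ballI impI \<eta>(1))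
      fix s assume "s \<in> {0..1}" "dist s t < \<eta>"
      then have "\<bar>support (g s) u - support (g t) u\<bar> \<le> e' * norm u"
        using \<eta>(2) t by (intro diff) (auto simp: dist_real_def)
      then show "dist (support (g s) u) (support (g t) u) < e" using small
        by (simp add: dist_real_def)
    qed
  qed
  have approx: "\<exists>\<eta>>0. \<forall>N t \<xi>. tagged_partition N t \<xi> \<longrightarrow> mesh N t \<le> \<eta> \<longrightarrow>
      (\<forall>u. \<bar>support (?C N t \<xi>) u - H u\<bar> \<le> e * norm u)" if e: "e > 0" for e
  proof -
    obtain \<eta> where \<eta>: "\<eta> > 0" "\<forall>s\<in>{0..1}. \<forall>t\<in>{0..1}. \<bar>s - t\<bar> \<le> \<eta> \<longrightarrow> hausdorff_dist (g s) (g t) \<le> e"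
      using unif[OF e] by blast
    show ?thesis
    proof (intro exI[of _ \<eta>] conjI allI impI \<eta>(1))
      fix N t \<xi> u assume tp: "tagged_partition N t \<xi>" and mesh: "mesh N t \<le> \<eta>"
      show "\<bar>support (?C N t \<xi>) u - H u\<bar> \<le> e * norm u"
        unfolding riemann_minkowski_sum_hull(4)[OF tp g] H_def
        by (rule riemann_sum_error[OF tp mesh cont]) (use \<eta>(2) diff in blast)
    qed
  qed
  have "\<exists>C. C \<in> nonempty_compacts \<and> C \<subseteq> cball 0 D \<and>
      (\<forall>u. \<bar>support C u - H u\<bar> \<le> 1 / real (Suc n) * norm u)" for n
  proof -
    obtain \<eta> where \<eta>: "\<eta> > 0" "\<forall>N t \<xi>. tagged_partition N t \<xi> \<longrightarrow> mesh N t \<le> \<eta> \<longrightarrow>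
      (\<forall>u. \<bar>support (?C N t \<xi>) u - H u\<bar> \<le> 1 / real (Suc n) * norm u)"
      using approx[of "1 / real (Suc n)"] by auto
    obtain N t \<xi> where tp: "tagged_partition N t \<xi>" and mesh: "mesh N t < \<eta>"
      using uniform_partition_exists[OF \<eta>(1)] by blast
    note T = tagged_partitionD[OF tp]
    have C: "?C N t \<xi> \<in> nonempty_compacts"
      using riemann_minkowski_sum_hull(2)[OF tp g] by (rule nonempty_convex_compactsD)
    have "?C N t \<xi> \<subseteq> cball 0 D"
    proof
      fix v assume v: "v \<in> ?C N t \<xi>"
      have s: "support (g x) v \<le> D * norm v" if x: "x \<in> {0..1}" for x
      proof -
        obtain c where c: "c \<in> g x" "support (g x) v = v \<bullet> c" using support_attained[OF gt[OF x]]
          by blast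
        have "v \<bullet> c \<le> norm v * norm c" by (rule norm_cauchy_schwarz)
        also have "\<dots> \<le> norm v * D" using c(1) D[OF x] by (intro mult_left_mono) auto
        finally show ?thesis using c by (simp add: mult.commute)
      qed
      have "v \<bullet> v \<le> support (?C N t \<xi>) v" by (rule support_upper[OF C v])
      also have "\<dots> \<le> (\<Sum>i=1..N. (t i - t (i - 1)) * (D * norm v))"
        unfolding riemann_minkowski_sum_hull(4)[OF tp g]
        using s T(7) T(4) by (intro sum_mono mult_left_mono) (auto simp: less_imp_le)
      also have "\<dots> = D * norm v"
        unfolding sum_distrib_right[symmetric] sum_partition_lengths by (simp add: T)
      finally have "norm v * norm v \<le> D * norm v" by (simp add: dot_square_norm power2_eq_square)
      moreover have "0 \<le> D"
        using D[of 0] nonempty_compactsD(2)[OF gt[of 0]]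
          by (force dest: order_trans[OF norm_ge_zero])
      ultimately show "v \<in> cball 0 D" by (cases "v = 0") auto
    qed
    then show ?thesis using C \<eta>(2) tp mesh by (intro exI[of _ "?C N t \<xi>"]) (auto simp: less_imp_le)
  qed
  then obtain C where C: "\<And>n. C n \<in> nonempty_compacts" "\<And>n. C n \<subseteq> cball 0 D"
      "\<And>n u. \<bar>support (C n) u - H u\<bar> \<le> 1 / real (Suc n) * norm u"
    by metis
  define I where "I = {v. \<forall>u. u \<bullet> v \<le> H u}"
  have e0: "(\<lambda>n. 1 / real (Suc n)) \<longlonglongrightarrow> 0" using LIMSEQ_inverse_real_of_nat
    by (simp add: inverse_eq_divide)
  have I: "I \<in> nonempty_convex_compacts" "\<And>u. support I u = H u"
    unfolding I_def using compact_limit_of_support[OF C(1,2) e0 C(3)] by auto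
  have "has_rm_integral g I"
    unfolding has_rm_integral_def
  proof (intro conjI allI impI g)
    show "I \<in> nonempty_compacts" using nonempty_convex_compactsD[OF I(1)] by simp
    fix \<epsilon> :: real assume \<epsilon>: "\<epsilon> > 0"
    obtain \<eta> where \<eta>: "\<eta> > 0" "\<forall>N t \<xi>. tagged_partition N t \<xi> \<longrightarrow> mesh N t \<le> \<eta> \<longrightarrow>
      (\<forall>u. \<bar>support (?C N t \<xi>) u - H u\<bar> \<le> \<epsilon> / 3 * norm u)"
      using approx[of "\<epsilon> / 3"] \<epsilon> by auto
    define \<theta> where "\<theta> = (\<epsilon> / (6 * (\<bar>D\<bar> + 1)))\<^sup>2"
    have D1: "\<bar>D\<bar> + 1 > 0" by simp
    have \<theta>: "\<theta> > 0" unfolding \<theta>_def using \<epsilon> D1 by simp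
    show "\<exists>\<eta>>0. \<forall>N t \<xi>. tagged_partition N t \<xi> \<and> mesh N t < \<eta> \<longrightarrow> hausdorff_dist (?S N t \<xi>) I < \<epsilon>"
    proof (intro exI[of _ "min \<eta> \<theta>"] conjI allI impI)
      show "min \<eta> \<theta> > 0" using \<eta> \<theta> by simp
      fix N t \<xi> assume a: "tagged_partition N t \<xi> \<and> mesh N t < min \<eta> \<theta>"
      then have tp: "tagged_partition N t \<xi>" and mesh: "mesh N t \<le> \<eta>" "mesh N t \<le> \<theta>" by auto
      note R = riemann_minkowski_sum_hull[OF tp g]
      have CC: "?C N t \<xi> \<in> nonempty_compacts" using nonempty_convex_compactsD[OF R(2)] by simp
      have "sqrt (mesh N t) \<le> \<epsilon> / (6 * (\<bar>D\<bar> + 1))"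
        using mesh(2) \<epsilon> D1 unfolding \<theta>_def
          by (intro real_le_lsqrt) (auto intro!: real_sqrt_le_iff[THEN iffD2])
      then have "2 * (\<bar>D\<bar> + 1) * sqrt (mesh N t) \<le> 2 * (\<bar>D\<bar> + 1) * (\<epsilon> / (6 * (\<bar>D\<bar> + 1)))"
        by (intro mult_left_mono) auto
      also have "\<dots> = \<epsilon> / 3" using D1 by (simp add: field_simps)
      finally have small: "2 * (\<bar>D\<bar> + 1) * sqrt (mesh N t) \<le> \<epsilon> / 3" .
      have "0 \<le> mesh N t"
        using mesh_bound[of 1 N t] tagged_partitionD(3)[OF tp] tagged_partitionD(4)[OF tp, of 1]
          by simp
      then have "2 * \<bar>D\<bar> * sqrt (mesh N t) \<le> 2 * (\<bar>D\<bar> + 1) * sqrt (mesh N t)"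
        by (intro mult_right_mono) auto
      with small have small': "2 * \<bar>D\<bar> * sqrt (mesh N t) \<le> \<epsilon> / 3" by simp
      have "hausdorff_dist (?S N t \<xi>) (?C N t \<xi>) \<le> \<epsilon> / 3"
      proof (rule hausdorff_dist_leI[OF R(1) CC])
        show "infdist a (?C N t \<xi>) \<le> \<epsilon> / 3" if "a \<in> ?S N t \<xi>" for a
          using that R(3) \<epsilon> by (subst infdist_zero) auto
        show "infdist b (?S N t \<xi>) \<le> \<epsilon> / 3" if "b \<in> ?C N t \<xi>" for b
          using infdist_Minkowski_sum_hull[OF tp D that] small' by simp
      qed
      moreover have "hausdorff_dist (?C N t \<xi>) I \<le> \<epsilon> / 3"
        using \<eta>(2) tp mesh \<epsilon> I(2) by (intro hausdorff_dist_le_support[OF R(2) I(1)]) auto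
      ultimately show "hausdorff_dist (?S N t \<xi>) I < \<epsilon>"
        using hausdorff_dist_triangle[OF R(1) CC nonempty_convex_compactsD(1)[OF I(1)]] \<epsilon> by simp
    qed
  qed
  then show ?thesis using I H_def by (intro bexI[of _ I]) auto
qed

lemma rm_integral_eq:
  assumes "has_rm_integral g I"
  shows "rm_integral g = I"
  unfolding rm_integral_def using assms
    by (rule the_equality) (rule has_rm_integral_unique[OF _ assms])

lemma hausdorff_dist_scale:
  assumes A: "A \<in> nonempty_compacts" and B: "B \<in> nonempty_compacts" and D: "A \<subseteq> cball 0 D" and q: "0
    \<le> q"
  shows "hausdorff_dist (scale_set p A) (scale_set q B) \<le> \<bar>p - q\<bar> * D + q * hausdorff_dist A B"
proof -
  have est: "dist (p *\<^sub>R a) (q *\<^sub>R b) \<le> \<bar>p - q\<bar> * D + q * hausdorff_dist A B"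
    if "a \<in> A" "dist a b \<le> hausdorff_dist A B" for a b
  proof -
    have "p *\<^sub>R a - q *\<^sub>R b = (p - q) *\<^sub>R a + q *\<^sub>R (a - b)" by (simp add: algebra_simps)
    then have "dist (p *\<^sub>R a) (q *\<^sub>R b) \<le> \<bar>p - q\<bar> * norm a + q * norm (a - b)"
      unfolding dist_norm using norm_triangle_ineq[of "(p - q) *\<^sub>R a" "q *\<^sub>R (a - b)"] q by simp
    also have "\<dots> \<le> \<bar>p - q\<bar> * D + q * hausdorff_dist A B"
      using that D q by (intro add_mono mult_left_mono) (auto simp: dist_norm)
    finally show ?thesis .
  qed
  show ?thesis
  proof (rule hausdorff_dist_leI[OF nonempty_compacts_scale[OF A] nonempty_compacts_scale[OF B]])
    fix v assume "v \<in> scale_set p A"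
    then obtain a where a: "a \<in> A" "v = p *\<^sub>R a" by (auto simp: scale_set_def)
    obtain b where b: "b \<in> B" "dist a b \<le> hausdorff_dist A B" using nearest_point[OF A B a(1)]
      by blast
    have "infdist v (scale_set q B) \<le> dist v (q *\<^sub>R b)"
      using b by (intro infdist_le) (auto simp: scale_set_def)
    then show "infdist v (scale_set q B) \<le> \<bar>p - q\<bar> * D + q * hausdorff_dist A B"
      using est[OF a(1) b(2)] a(2) by simp
  next
    fix v assume "v \<in> scale_set q B"
    then obtain b where b: "b \<in> B" "v = q *\<^sub>R b" by (auto simp: scale_set_def)
    obtain a where a: "a \<in> A" "dist b a \<le> hausdorff_dist B A" using nearest_point[OF B A b(1)]
      by blast
    have "infdist v (scale_set p A) \<le> dist v (p *\<^sub>R a)"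
      using a by (intro infdist_le) (auto simp: scale_set_def)
    then show "infdist v (scale_set p A) \<le> \<bar>p - q\<bar> * D + q * hausdorff_dist A B"
      using est[OF a(1), of b] a(2) b(2) hausdorff_dist_commute[of A B] by (simp add: dist_commute)
  qed
qed

context weighted_modulus begin

lemma H_classD:
  assumes "f \<in> H_class \<omega>"
  shows "t \<in> {0..1} \<Longrightarrow> f t \<in> nonempty_compacts"
    and "s \<in> {0..1} \<Longrightarrow> t \<in> {0..1} \<Longrightarrow> hausdorff_dist (f s) (f t) \<le> \<omega> \<bar>s - t\<bar>"
  using assms unfolding H_class_def by auto

lemma H_class_bounded:
  assumes f: "f \<in> H_class \<omega>"
  obtains D where "D \<ge> 0" "\<And>t. t \<in> {0..1} \<Longrightarrow> f t \<subseteq> cball 0 D"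
proof -
  have f0: "f 0 \<in> nonempty_compacts" using H_classD(1)[OF f] by simp
  obtain r where r: "r > 0" "\<forall>x\<in>f 0. norm x \<le> r" using nonempty_compactsD(4)[OF f0] bounded_pos
    by blast
  show ?thesis
  proof (rule that[of "r + \<omega> 1"])
    show "r + \<omega> 1 \<ge> 0" using r modulus_nonneg[of 1] by simp
    fix t :: real assume t: "t \<in> {0..1}"
    show "f t \<subseteq> cball 0 (r + \<omega> 1)"
    proof
      fix a assume a: "a \<in> f t"
      obtain b where b: "b \<in> f 0" "dist a b \<le> hausdorff_dist (f t) (f 0)"
        using nearest_point[OF H_classD(1)[OF f t] f0 a] by blast
      have "hausdorff_dist (f t) (f 0) \<le> \<omega> \<bar>t - 0\<bar>" using H_classD(2)[OF f t, of 0] by simp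
      also have "\<dots> \<le> \<omega> 1" using t by (intro modulus_mono) auto
      finally have "dist a b \<le> \<omega> 1" using b(2) by simp
      moreover have "norm b \<le> r" using r b by blast
      ultimately show "a \<in> cball 0 (r + \<omega> 1)"
        using norm_triangle_ineq[of b "a - b"] by (simp add: dist_norm)
    qed
  qed
qed

lemma rm_integral_weighted:
  fixes f :: "real \<Rightarrow> 'a::euclidean_space set"
  assumes f: "f \<in> H_class \<omega>"
  defines "I \<equiv> rm_integral (\<lambda>x. scale_set (P x) (f x))"
  shows "I \<in> nonempty_convex_compacts"
    and "support I u = integral {0..1} (\<lambda>t. P t * support (f t) u)"
proof -
  obtain D where D: "D \<ge> 0" "\<And>t. t \<in> {0..1} \<Longrightarrow> f t \<subseteq> cball 0 D" using H_class_bounded[OF f] by blast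
  obtain M where M: "M > 0" "\<And>t. t \<in> {0..1} \<Longrightarrow> P t \<le> M" using P_bounded by blast
  let ?g = "\<lambda>x. scale_set (P x) (f x)"
  have "\<exists>I\<in>nonempty_convex_compacts. has_rm_integral ?g I \<and>
    (\<forall>u. support I u = integral {0..1} (\<lambda>t. support (?g t) u))"
  proof (rule has_rm_integral_support)
    show "?g \<in> {0..1} \<rightarrow> nonempty_compacts"
      by (intro Pi_I nonempty_compacts_scale H_classD(1)[OF f])
    show "?g x \<subseteq> cball 0 (M * D)" if x: "x \<in> {0..1}" for x
    proof
      fix v assume "v \<in> ?g x"
      then obtain a where "a \<in> f x" "v = P x *\<^sub>R a" by (auto simp: scale_set_def)
      then show "v \<in> cball 0 (M * D)"
        using D(2)[OF x] M(2)[OF x] P_nonneg[OF x] M(1) by (auto intro!: mult_mono)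
    qed
    fix e :: real assume e: "e > 0"
    have "e / (2 * (D + 1)) > 0" using e D(1) by simp
    then obtain \<eta> where \<eta>: "\<eta> > 0" "\<And>x y. x \<in> {0..1} \<Longrightarrow> y \<in> {0..1} \<Longrightarrow> \<bar>x - y\<bar> \<le> \<eta> \<Longrightarrow> \<bar>P x - P y\<bar>
      \<le> e / (2 * (D + 1))"
      using uniformly_continuous_unit_interval[OF P_cont] by blast
    obtain \<theta> where \<theta>: "\<theta> > 0" "\<omega> \<theta> \<le> e / (2 * M)" using modulus_small[of "e / (2 * M)"] e M(1)
      by auto
    show "\<exists>\<eta>>0. \<forall>s\<in>{0..1}. \<forall>t\<in>{0..1}. \<bar>s - t\<bar> \<le> \<eta> \<longrightarrow> hausdorff_dist (?g s) (?g t) \<le> e"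
    proof (intro exI[of _ "min \<eta> \<theta>"] conjI ballI impI)
      show "min \<eta> \<theta> > 0" using \<eta> \<theta> by simp
      fix s t :: real assume st: "s \<in> {0..1}" "t \<in> {0..1}" "\<bar>s - t\<bar> \<le> min \<eta> \<theta>"
      have fst: "hausdorff_dist (f s) (f t) \<le> e / (2 * M)"
        using H_classD(2)[OF f st(1,2)] modulus_mono[of "\<bar>s - t\<bar>" \<theta>] st(3) \<theta>(2) by simp
      have "hausdorff_dist (?g s) (?g t) \<le> \<bar>P s - P t\<bar> * D + P t * hausdorff_dist (f s) (f t)"
        using st P_nonneg by (intro hausdorff_dist_scale H_classD(1)[OF f] D(2)) auto
      also have "\<dots> \<le> e / (2 * (D + 1)) * (D + 1) + M * (e / (2 * M))"
        using st \<eta>(2)[of s t] D(1) M P_nonneg fst e hausdorff_dist_nonneg[OF H_classD(1)[OF f st(1)]]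
        by (intro add_mono mult_mono) auto
      also have "\<dots> = e"
      proof -
        have "e / (2 * (D + 1)) * (D + 1) = e / 2" using D(1) by (intro half_divide_cancel) simp
        moreover have "M * (e / (2 * M)) = e / 2"
          using half_divide_cancel[OF M(1), of e] by (simp only: mult.commute[of M])
        ultimately show ?thesis by linarith
      qed
      finally show "hausdorff_dist (?g s) (?g t) \<le> e" .
    qed
  qed
  then obtain J where J: "J \<in> nonempty_convex_compacts" "has_rm_integral ?g J"
    "\<And>u. support J u = integral {0..1} (\<lambda>t. support (?g t) u)" by blast
  have IJ: "I = J" unfolding I_def using rm_integral_eq J(2) by blast
  show "I \<in> nonempty_convex_compacts" using J IJ by simp
  have "support I u = integral {0..1} (\<lambda>t. support (?g t) u)" using J IJ by simp
  also have "\<dots> = integral {0..1} (\<lambda>t. P t * support (f t) u)"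
    using H_classD(1)[OF f] P_nonneg by (intro integral_cong) (simp add: support_scale)
  finally show "support I u = integral {0..1} (\<lambda>t. P t * support (f t) u)" .
qed

lemma support_continuous:
  fixes f :: "real \<Rightarrow> 'a::euclidean_space set"
  assumes f: "f \<in> H_class \<omega>"
  shows "continuous_on {0..1} (\<lambda>t. support (f t) u)"
  unfolding continuous_on_iff
proof (intro ballI allI impI)
  fix t e :: real assume t: "t \<in> {0..1}" and e: "e > 0"
  have u: "norm u + 1 > 0" by (simp add: add_nonneg_pos)
  obtain \<eta> where \<eta>: "\<eta> > 0" "\<omega> \<eta> \<le> e / (2 * (norm u + 1))"
    using modulus_small[of "e / (2 * (norm u + 1))"] e u by auto
  show "\<exists>d>0. \<forall>x'\<in>{0..1}. dist x' t < d \<longrightarrow> dist (support (f x') u) (support (f t) u) < e"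
  proof (intro exI[of _ \<eta>] conjI ballI impI \<eta>(1))
    fix s assume s: "s \<in> {0..1}" "dist s t < \<eta>"
    have "\<bar>support (f s) u - support (f t) u\<bar> \<le> hausdorff_dist (f s) (f t) * norm u"
      by (intro support_diff_le H_classD(1)[OF f] s t)
    also have "\<dots> \<le> e / (2 * (norm u + 1)) * (norm u + 1)"
      using H_classD(2)[OF f s(1) t] modulus_mono[of "\<bar>s - t\<bar>" \<eta>] s(2) \<eta>(2) e
      by (intro mult_mono) (auto simp: dist_real_def)
    also have "\<dots> = e / 2" by (rule half_divide_cancel[OF u])
    finally show "dist (support (f s) u) (support (f t) u) < e" using e by (simp add: dist_real_def)
  qed
qed

text \<open>The adversary: two functions with values \<open>\<plusminus>\<omega>(d(t)) b\<close>, indistinguishable from their values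
  \<open>{0}\<close> at the knots, whose integrals have support function values \<open>R\<close> and \<open>-R\<close> in the direction
  \<open>b\<close>.\<close>

lemma knots_error_ge:
  fixes xs :: "real list"
  assumes xs: "xs \<noteq> []" "set xs \<subseteq> {0..1}"
  shows "ereal (integral {0..1} (\<lambda>t. P t * \<omega> (infdist t (set xs))))
    \<le> knots_error P (H_class \<omega> :: (real \<Rightarrow> 'a::euclidean_space set) set) xs"
  unfolding knots_error_def
proof (rule INF_greatest)
  fix \<Phi> :: "'a set list \<Rightarrow> 'a set"
  assume \<Phi>: "\<Phi> \<in> recovery_methods (length xs)"
  define R where "R = integral {0..1} (\<lambda>t. P t * \<omega> (infdist t (set xs)))"
  obtain b :: 'a where b: "b \<in> Basis" using nonempty_Basis by blast
  define F :: "real \<Rightarrow> real \<Rightarrow> 'a set" where "F \<sigma> t = {(\<sigma> * \<omega> (infdist t (set xs))) *\<^sub>R b}" for \<sigma> t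
  define I where "I \<sigma> = rm_integral (\<lambda>x. scale_set (P x) (F \<sigma> x))" for \<sigma>
  define Z where "Z = \<Phi> (map (\<lambda>x. {0}) xs)"
  have dist_le: "\<bar>\<omega> (infdist s (set xs)) - \<omega> (infdist t (set xs))\<bar> \<le> \<omega> \<bar>s - t\<bar>" for s t
  proof -
    have *: "\<omega> p \<le> \<omega> q + \<omega> \<bar>s - t\<bar>" if "0 \<le> p" "0 \<le> q" "p \<le> q + \<bar>s - t\<bar>" for p q
      using modulus_mono[OF that(1,3)] modulus_add[of q "\<bar>s - t\<bar>"] that by simp
    show ?thesis
      using *[of "infdist s (set xs)" "infdist t (set xs)"] *[of "infdist t (set xs)" "infdist s (set xs)"]
        infdist_triangle_abs[of s "set xs" t]
      by (simp add: infdist_nonneg dist_real_def abs_le_iff)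
  qed
  have F: "F \<sigma> \<in> H_class \<omega>" if \<sigma>: "\<bar>\<sigma>\<bar> = 1" for \<sigma>
  proof -
    have nc: "F \<sigma> t \<in> nonempty_compacts" for t unfolding F_def nonempty_compacts_def by simp
    have "hausdorff_dist (F \<sigma> s) (F \<sigma> t) \<le> \<omega> \<bar>s - t\<bar>" for s t
    proof (rule hausdorff_dist_leI[OF nc nc])
      have d: "dist ((\<sigma> * \<omega> (infdist s (set xs))) *\<^sub>R b) ((\<sigma> * \<omega> (infdist t (set xs))) *\<^sub>R b)
        \<le> \<omega> \<bar>s - t\<bar>" for s t
        using dist_le[of s t] b \<sigma>
        by (simp add: dist_norm scaleR_diff_left[symmetric] right_diff_distrib[symmetric] abs_mult)
      show "infdist x (F \<sigma> t) \<le> \<omega> \<bar>s - t\<bar>" if "x \<in> F \<sigma> s" for x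
        using that d[of s t] unfolding F_def by simp
      show "infdist x (F \<sigma> s) \<le> \<omega> \<bar>s - t\<bar>" if "x \<in> F \<sigma> t" for x
        using that d[of t s] unfolding F_def by (simp add: abs_minus_commute)
    qed
    then show ?thesis using nc unfolding H_class_def by auto
  qed
  have zero: "map (F \<sigma>) xs = map (\<lambda>x. {0}) xs" for \<sigma>
    unfolding F_def using modulus_0 by simp
  have Z: "Z \<in> nonempty_convex_compacts"
  proof -
    have "length (map (\<lambda>x. {0::'a}) xs) = length xs
      \<and> set (map (\<lambda>x. {0::'a}) xs) \<subseteq> nonempty_compacts"
      by (auto simp: nonempty_compacts_def)
    then show ?thesis using \<Phi> unfolding Z_def recovery_methods_def by blast
  qed
  have err: "ereal (hausdorff_dist (I \<sigma>) Z) \<le> method_error P (H_class \<omega>) xs \<Phi>" if "\<bar>\<sigma>\<bar> = 1" for \<sigma>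
    unfolding method_error_def I_def Z_def zero[of \<sigma>, symmetric] by (rule SUP_upper[OF F[OF that]])
  have supp: "support (I \<sigma>) b = \<sigma> * R" if "\<bar>\<sigma>\<bar> = 1" for \<sigma>
  proof -
    have "support (I \<sigma>) b = integral {0..1} (\<lambda>t. P t * support (F \<sigma> t) b)"
      unfolding I_def by (rule rm_integral_weighted(2)[OF F[OF that]])
    also have "(\<lambda>t. P t * support (F \<sigma> t) b) = (\<lambda>t. \<sigma> * (P t * \<omega> (infdist t (set xs))))"
      using b by (auto simp: F_def support_def mult_ac)
    finally show ?thesis unfolding R_def by simp
  qed
  have I: "I \<sigma> \<in> nonempty_compacts" if "\<bar>\<sigma>\<bar> = 1" for \<sigma>
    unfolding I_def using rm_integral_weighted(1)[OF F[OF that]] nonempty_convex_compactsD by blast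
  have "\<bar>support (I \<sigma>) b - support Z b\<bar> \<le> hausdorff_dist (I \<sigma>) Z" if "\<bar>\<sigma>\<bar> = 1" for \<sigma>
    using support_diff_le[OF I[OF that] nonempty_convex_compactsD(1)[OF Z], of b] b by simp
  from this[of 1] this[of "-1"] have "R \<le> hausdorff_dist (I 1) Z \<or> R \<le> hausdorff_dist (I (-1)) Z"
    using supp[of 1] supp[of "-1"] by auto
  then show "ereal (integral {0..1} (\<lambda>t. P t * \<omega> (infdist t (set xs))))
    \<le> method_error P (H_class \<omega>) xs \<Phi>"
    unfolding R_def[symmetric] using err[of 1] err[of "-1"] by (auto elim: order_trans[rotated])
qed

end

section \<open>Optimal knots\<close>

text \<open>Increasing enumeration of a finite set of points that contains \<open>0\<close> and \<open>1\<close>; no point of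
  the set lies strictly between two consecutive ones.\<close>

lemma finite_set_gaps:
  fixes Z :: "real set"
  assumes Z: "finite Z" "0 \<in> Z" "1 \<in> Z" "Z \<subseteq> {0..1}"
  obtains z :: "nat \<Rightarrow> real" where "z 0 = 0" "z (card Z - 1) = 1"
    "\<And>i. i \<in> {1..card Z - 1} \<Longrightarrow> z (i - 1) < z i"
    "\<And>i q. i \<in> {1..card Z - 1} \<Longrightarrow> q \<in> Z \<Longrightarrow> q \<le> z (i - 1) \<or> z i \<le> q"
proof -
  define zs where "zs = sorted_list_of_set Z"
  have set: "set zs = Z" and len: "length zs = card Z" and srt: "sorted_wrt (<) zs"
    unfolding zs_def using Z(1) by auto
  have mono: "zs ! i \<le> zs ! j" if "i \<le> j" "j < length zs" for i j
    using sorted_wrt_nth_less[OF srt, of i j] that by (cases "i = j") auto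
  have memb: "zs ! i \<in> Z" if "i < length zs" for i using that set nth_mem by blast
  have idx: "\<exists>j<length zs. zs ! j = q" if "q \<in> Z" for q using that set in_set_conv_nth[of q zs]
    by auto
  show ?thesis
  proof (rule that[of "\<lambda>i. zs ! i"])
    obtain j where "j < length zs" "zs ! j = 0" using idx[OF Z(2)] by auto
    then show "zs ! 0 = 0" using mono[of 0 j] memb[of 0] Z(4) by fastforce
    obtain k where "k < length zs" "zs ! k = 1" using idx[OF Z(3)] by auto
    then show "zs ! (card Z - 1) = 1" using mono[of k "card Z - 1"] memb[of "card Z - 1"] Z(4) len
      by fastforce
    show "zs ! (i - 1) < zs ! i" if "i \<in> {1..card Z - 1}" for i
      using that len by (intro sorted_wrt_nth_less[OF srt]) auto
    show "q \<le> zs ! (i - 1) \<or> zs ! i \<le> q" if i: "i \<in> {1..card Z - 1}" and q: "q \<in> Z" for i q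
    proof -
      obtain j where j: "j < length zs" "zs ! j = q" using idx[OF q] by auto
      show ?thesis
      proof (cases "j \<le> i - 1")
        case True
        then show ?thesis using mono[of j "i - 1"] j i len by auto
      next
        case False
        then show ?thesis using mono[of i j] j by auto
      qed
    qed
  qed
qed

lemma infdist_ge_gap:
  assumes X: "finite X" "X \<noteq> {}" and t: "t \<in> {a..b}" and gap: "\<And>q. q \<in> X \<Longrightarrow> q \<le> a \<or> b \<le> q"
  shows "min (t - a) (b - t) \<le> infdist (t::real) X"
proof -
  obtain q where "q \<in> X" "infdist t X = dist t q"
    using infdist_attains_inf[of X t] X finite_imp_closed by blast
  then show ?thesis using gap[of q] t by (auto simp: dist_real_def)
qed

context weighted_modulus begin

lemma weighted_distance_continuous:
  assumes "X \<noteq> {}"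
  shows "continuous_on {0..1} (\<lambda>t. P t * \<omega> (infdist t X))"
  by (intro continuous_intros P_cont continuous_on_compose2[OF modulus_cont])
    (auto simp: infdist_nonneg intro!: continuous_intros)

text \<open>The constant \<open>K\<close> depends on \<open>\<epsilon>\<close> only. The grid of mesh \<open>1/K\<close> forces all gaps to be so
  short that \<open>\<gamma>\<close> is close to its linear approximation and that sums over the gaps approximate
  \<open>B\<close>.\<close>

lemma weighted_distance_integral_ge:
  assumes \<epsilon>: "\<epsilon> > 0" "2 * \<epsilon> \<le> total_density"
  shows "\<exists>K. \<forall>n>0. \<forall>xs\<in>knot_lists n.
    real (n + K) * Omega \<omega> ((total_density - 2 * \<epsilon>) / real (n + K))
      \<le> integral {0..1} (\<lambda>t. P t * \<omega> (infdist t (set xs)))"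
proof -
  obtain h where h: "h > 0" "\<And>x t. 0 < x \<Longrightarrow> x \<le> h \<Longrightarrow> t \<in> {0..1} \<Longrightarrow>
    \<bar>gamma_fun \<omega> (P t) x - gamma_limit \<omega> (P t) * x\<bar> \<le> \<epsilon> * x"
    using gamma_P_uniform[OF \<epsilon>(1)] by blast
  obtain \<eta> where \<eta>: "\<eta> > 0" "\<And>x y. x \<in> {0..1} \<Longrightarrow> y \<in> {0..1} \<Longrightarrow> \<bar>x - y\<bar> \<le> \<eta> \<Longrightarrow>
      \<bar>gamma_limit \<omega> (P x) - gamma_limit \<omega> (P y)\<bar> \<le> \<epsilon>"
    using uniformly_continuous_unit_interval[OF gamma_limit_P_cont \<epsilon>(1)] by blast
  obtain K where K: "K > 0" "1 / real K < min h \<eta>"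
    using h(1) \<eta>(1) by (metis inverse_eq_divide min_less_iff_conj reals_Archimedean zero_less_Suc)
  show ?thesis
  proof (intro exI[of _ K] allI impI ballI)
    fix n :: nat and xs assume n: "n > 0" and xs: "xs \<in> knot_lists n"
    let ?X = "set xs"
    have X: "finite ?X" "?X \<noteq> {}" "?X \<subseteq> {0..1}" "card ?X \<le> n"
      using xs n card_length[of xs] unfolding knot_lists_def by auto
    define G where "G = (\<lambda>j. real j / real K) ` {0..K}"
    define Z where "Z = ?X \<union> G"
    have "0 \<in> G" unfolding G_def by (rule image_eqI[of _ _ 0]) auto
    moreover have "1 \<in> G" unfolding G_def by (rule image_eqI[of _ _ K]) (use K in auto)
    moreover have "G \<subseteq> {0..1}" unfolding G_def using K by auto
    ultimately have Z: "finite Z" "0 \<in> Z" "1 \<in> Z" "Z \<subseteq> {0..1}"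
      unfolding Z_def using X by (auto simp: G_def)
    have "card G \<le> K + 1" unfolding G_def using card_image_le[of "{0..K}"] by simp
    then have cZ: "card Z - 1 \<le> n + K" unfolding Z_def using card_Un_le[of ?X G] X(4) by simp
    define N where "N = card Z - 1"
    obtain z where z: "z 0 = 0" "z N = 1" "\<And>i. i \<in> {1..N} \<Longrightarrow> z (i - 1) < z i"
      "\<And>i q. i \<in> {1..N} \<Longrightarrow> q \<in> Z \<Longrightarrow> q \<le> z (i - 1) \<or> z i \<le> q"
      unfolding N_def using finite_set_gaps[OF Z] by metis
    have "tagged_partition N z z" using z unfolding tagged_partition_def by (auto simp: less_imp_le)
    note sub = tagged_partitionD(6)[OF this]
    have "\<exists>\<xi>\<in>{z (i - 1)..z i}. \<forall>t\<in>{z (i - 1)..z i}. P \<xi> \<le> P t" if i: "i \<in> {1..N}" for i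
      using continuous_attains_inf[of "{z (i - 1)..z i}" P] continuous_on_subset[OF P_cont sub[OF i]] z(3)[OF i]
      by auto
    then obtain \<xi> where \<xi>: "\<And>i. i \<in> {1..N} \<Longrightarrow> \<xi> i \<in> {z (i - 1)..z i}"
      "\<And>i t. i \<in> {1..N} \<Longrightarrow> t \<in> {z (i - 1)..z i} \<Longrightarrow> P (\<xi> i) \<le> P t" by metis
    have tp: "tagged_partition N z \<xi>" using z \<xi>(1) unfolding tagged_partition_def by auto
    note T = tagged_partitionD[OF tp]
    have short: "z i - z (i - 1) \<le> 1 / real K" if i: "i \<in> {1..N}" for i
    proof -
      define j where "j = nat \<lfloor>z (i - 1) * real K\<rfloor>"
      have z01: "0 \<le> z (i - 1)" "z (i - 1) < 1" using sub[OF i] z(3)[OF i] by auto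
      have "real j = of_int \<lfloor>z (i - 1) * real K\<rfloor>" unfolding j_def using z01 by simp
      then have j: "real j \<le> z (i - 1) * real K" "z (i - 1) * real K < real j + 1" by linarith+
      have "z (i - 1) * real K < real K" using z01 K by simp
      then have "real j < real K" using j(1) by linarith
      then have "real (Suc j) / real K \<in> G" unfolding G_def by (intro imageI) auto
      then have "real (Suc j) / real K \<le> z (i - 1) \<or> z i \<le> real (Suc j) / real K"
        using z(4)[OF i] unfolding Z_def by auto
      moreover have "z (i - 1) < real (Suc j) / real K" using j(2) K by (simp add: field_simps)
      moreover have "real (Suc j) / real K \<le> z (i - 1) + 1 / real K"
        using j(1) K by (simp add: field_simps)
      ultimately show ?thesis by linarith
    qed
    have mesh: "mesh N z \<le> 1 / real K"
      unfolding mesh_def using T(3) short by (subst Max_le_iff) auto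
    \<comment> \<open>The maximum with 0 matters only where \<open>P\<close> is small: there \<open>l(P) - \<epsilon>\<close> may be negative.\<close>
    define y where "y i = max 0 ((gamma_limit \<omega> (P (\<xi> i)) - \<epsilon>) * (z i - z (i - 1)))" for i
    have piece: "Omega \<omega> (y i) \<le> integral {z (i - 1)..z i} (\<lambda>t. P t * \<omega> (infdist t ?X))"
      if i: "i \<in> {1..N}" for i
    proof -
      define d where "d = z i - z (i - 1)"
      have d: "0 < d" "d \<le> h" unfolding d_def using z(3)[OF i] short[OF i] K by auto
      have p: "0 \<le> P (\<xi> i)" using T(7)[OF i] P_nonneg by blast
      have "(gamma_limit \<omega> (P (\<xi> i)) - \<epsilon>) * d \<le> gamma_fun \<omega> (P (\<xi> i)) d"
        using h(2)[OF d T(7)[OF i]] by (simp add: abs_le_iff algebra_simps)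
      then have "y i \<le> gamma_fun \<omega> (P (\<xi> i)) d"
        unfolding y_def d_def[symmetric] using gamma_fun(1)[OF p, of d] d by simp
      then have "Omega \<omega> (y i) \<le> Omega \<omega> (gamma_fun \<omega> (P (\<xi> i)) d)"
        by (intro Omega_mono) (simp_all add: y_def)
      also have "\<dots> = P (\<xi> i) * Omega \<omega> d" using gamma_fun(2)[OF p, of d] d by simp
      also have "\<dots> = integral {z (i - 1)..z i} (\<lambda>t. P (\<xi> i) * \<omega> (min (t - z (i - 1)) (z i - t)))"
        using has_integral_modulus_gap[of "z (i - 1)" "z i"] z(3)[OF i] unfolding d_def
        by (simp add: integral_unique less_imp_le)
      also have "\<dots> \<le> integral {z (i - 1)..z i} (\<lambda>t. P t * \<omega> (infdist t ?X))"
      proof (rule integral_le)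
        show "(\<lambda>t. P (\<xi> i) * \<omega> (min (t - z (i - 1)) (z i - t))) integrable_on {z (i - 1)..z i}"
          using has_integral_modulus_gap[of "z (i - 1)" "z i"] z(3)[OF i]
          by (intro integrable_on_mult_right) (auto simp: less_imp_le integrable_on_def)
        show "(\<lambda>t. P t * \<omega> (infdist t ?X)) integrable_on {z (i - 1)..z i}"
          by (intro integrable_continuous_interval continuous_on_subset[OF weighted_distance_continuous[OF X(2)] sub[OF i]])
        fix t assume t: "t \<in> {z (i - 1)..z i}"
        have "min (t - z (i - 1)) (z i - t) \<le> infdist t ?X"
          using z(4)[OF i] unfolding Z_def by (intro infdist_ge_gap X t) auto
        then have "\<omega> (min (t - z (i - 1)) (z i - t)) \<le> \<omega> (infdist t ?X)"
          by (rule modulus_mono[rotated]) (use t in auto)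
        moreover have "0 \<le> \<omega> (min (t - z (i - 1)) (z i - t))"
          by (rule modulus_nonneg) (use t in auto)
        ultimately show "P (\<xi> i) * \<omega> (min (t - z (i - 1)) (z i - t)) \<le> P t * \<omega> (infdist t ?X)"
          using \<xi>(2)[OF i t] p by (intro mult_mono) linarith+
      qed
      finally show ?thesis .
    qed
    have "\<bar>(\<Sum>i=1..N. (z i - z (i - 1)) * gamma_limit \<omega> (P (\<xi> i))) - total_density\<bar> \<le> \<epsilon>"
      unfolding total_density_def
      by (rule riemann_sum_error[OF tp _ gamma_limit_P_cont \<eta>(2)]) (use mesh K in auto)
    moreover have "(\<Sum>i=1..N. (z i - z (i - 1)) * gamma_limit \<omega> (P (\<xi> i))) - \<epsilon>
        = (\<Sum>i=1..N. (gamma_limit \<omega> (P (\<xi> i)) - \<epsilon>) * (z i - z (i - 1)))"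
    proof -
      have "(\<Sum>i=1..N. \<epsilon> * (z i - z (i - 1))) = \<epsilon>"
        unfolding sum_distrib_left[symmetric] sum_partition_lengths by (simp add: z)
      moreover have "(\<Sum>i=1..N. (gamma_limit \<omega> (P (\<xi> i)) - \<epsilon>) * (z i - z (i - 1)))
          = (\<Sum>i=1..N. (z i - z (i - 1)) * gamma_limit \<omega> (P (\<xi> i))) - (\<Sum>i=1..N. \<epsilon> * (z i - z (i - 1)))"
        unfolding sum_subtractf[symmetric] by (intro sum.cong) (simp_all add: algebra_simps)
      ultimately show ?thesis by simp
    qed
    moreover have "\<dots> \<le> (\<Sum>i=1..N. y i)" unfolding y_def by (intro sum_mono) simp
    ultimately have ysum: "total_density - 2 * \<epsilon> \<le> (\<Sum>i=1..N. y i)" by linarith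
    have N: "N > 0" "N \<le> n + K" using T(3) cZ unfolding N_def by auto
    have "real (n + K) * Omega \<omega> ((total_density - 2 * \<epsilon>) / real (n + K))
      \<le> real N * Omega \<omega> ((total_density - 2 * \<epsilon>) / real N)"
      using N \<epsilon> by (intro Omega_split_antimono) auto
    also have "\<dots> \<le> real N * Omega \<omega> ((\<Sum>i=1..N. y i) / real N)"
      using N \<epsilon> ysum by (intro mult_left_mono Omega_mono divide_right_mono) auto
    also have "\<dots> \<le> (\<Sum>i=1..N. Omega \<omega> (y i))"
      using Omega_jensen[of "{1..N}" y] N by (simp add: y_def)
    also have "\<dots> \<le> (\<Sum>i=1..N. integral {z (i - 1)..z i} (\<lambda>t. P t * \<omega> (infdist t ?X)))"
      by (intro sum_mono piece)
    also have "\<dots> = integral {z 0..z N} (\<lambda>t. P t * \<omega> (infdist t ?X))"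
      using z(3) integrable_continuous_interval[OF weighted_distance_continuous[OF X(2)]]
      by (intro integral_partition[symmetric]) (auto simp: z(1,2) less_imp_le)
    finally show "real (n + K) * Omega \<omega> ((total_density - 2 * \<epsilon>) / real (n + K))
      \<le> integral {0..1} (\<lambda>t. P t * \<omega> (infdist t ?X))" by (simp add: z(1,2))
  qed
qed

text \<open>The method of the upper bound for cells \<open>[a\<^sub>i\<^sub>-\<^sub>1, a\<^sub>i]\<close> with the knots at their
  midpoints. The \<open>i\<close>-th knot has index \<open>i - 1\<close> in the list.\<close>

lemma knots_error_le:
  fixes a :: "nat \<Rightarrow> real"
  assumes a: "a 0 = 0" "a n = 1" "\<And>i. i \<in> {1..n} \<Longrightarrow> a (i - 1) < a i"
    and C: "\<And>i t. i \<in> {1..n} \<Longrightarrow> t \<in> {a (i - 1)..a i} \<Longrightarrow> P t \<le> C i"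
  defines "xs \<equiv> map (\<lambda>i. (a i + a (Suc i)) / 2) [0..<n]"
  shows "xs \<in> knot_lists n"
    and "knots_error P (H_class \<omega> :: (real \<Rightarrow> 'a::euclidean_space set) set) xs
      \<le> ereal (\<Sum>i=1..n. C i * Omega \<omega> (a i - a (i - 1)))"
proof -
  have tp: "tagged_partition n a (\<lambda>i. (a (i - 1) + a i) / 2)"
    unfolding tagged_partition_def using a by (force simp: field_simps)
  note T = tagged_partitionD[OF tp]
  define x where "x i = (a (i - 1) + a i) / 2" for i
  have xs_nth: "xs ! (i - 1) = x i" if "i \<in> {1..n}" for i
    using that unfolding xs_def x_def by (cases i) auto
  have x01: "x i \<in> {0..1}" if "i \<in> {1..n}" for i using T(7)[OF that] unfolding x_def .
  have len: "length xs = n" unfolding xs_def by simp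
  have step: "a i < a (Suc i)" if "i < n" for i using a(3)[of "Suc i"] that by simp
  have le: "a i \<le> a j" if "i \<le> j" "j \<le> n" for i j
    using partition_points_le[of n a i j] a(3) that by (auto simp: less_imp_le)
  show knots: "xs \<in> knot_lists n"
    unfolding knot_lists_def
  proof (intro CollectI conjI len)
    show "sorted_wrt (<) xs"
      unfolding sorted_wrt_iff_nth_less
    proof (intro allI impI)
      fix i j assume "i < j" "j < length xs"
      then show "xs ! i < xs ! j"
        using le[of "Suc i" j] step[of i] step[of j] unfolding xs_def by simp
    qed
    show "set xs \<subseteq> {0..1}"
    proof
      fix y assume "y \<in> set xs"
      then obtain i where "i < n" "y = (a i + a (Suc i)) / 2" unfolding xs_def by auto
      then show "y \<in> {0..1}" using x01[of "Suc i"] unfolding x_def by simp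
    qed
  qed
  define c where "c i = integral {a (i - 1)..a i} P" for i
  define E where "E = (\<Sum>i=1..n. C i * Omega \<omega> (a i - a (i - 1)))"
  define \<Phi> :: "'a set list \<Rightarrow> 'a set" where "\<Phi> As
    = (\<Sum>i\<in>{1..n}. scale_set (c i) (convex hull (As ! (i - 1))))" for As
  have \<Phi>: "\<Phi> \<in> recovery_methods (length xs)"
    unfolding recovery_methods_def \<Phi>_def
  proof (intro CollectI allI impI nonempty_convex_compacts_combination)
    fix As :: "'a set list" and i assume "length As = length xs
      \<and> set As \<subseteq> nonempty_compacts" "i \<in> {1..n}"
    then show "As ! (i - 1) \<in> nonempty_compacts" using len nth_mem[of "i - 1" As] by auto
  qed
  have Pint: "P integrable_on {a (i - 1)..a i}" if "i \<in> {1..n}" for i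
    using continuous_on_subset[OF P_cont T(6)[OF that]] by (rule integrable_continuous_interval)
  have c0: "0 \<le> c i" if "i \<in> {1..n}" for i
    unfolding c_def using Pint[OF that] P_nonneg T(6)[OF that] by (intro integral_nonneg) auto
  have C0: "0 \<le> C i" if "i \<in> {1..n}" for i
    using C[OF that, of "a i"] P_nonneg[of "a i"] T(6)[OF that] a(3)[OF that] by auto
  have E0: "0 \<le> E"
    unfolding E_def using C0 a(3)
      by (intro sum_nonneg mult_nonneg_nonneg Omega_nonneg) (auto simp: less_imp_le)
  have "hausdorff_dist (rm_integral (\<lambda>x. scale_set (P x) (f x))) (\<Phi> (map f xs)) \<le> E"
    if f: "f \<in> H_class \<omega>" for f :: "real \<Rightarrow> 'a set"
  proof (rule hausdorff_dist_le_support[OF rm_integral_weighted(1)[OF f] _ E0])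
    have fx: "f (x i) \<in> nonempty_compacts" if "i \<in> {1..n}" for i
      using H_classD(1)[OF f x01[OF that]] .
    have \<Phi>f: "\<Phi> (map f xs) = (\<Sum>i\<in>{1..n}. scale_set (c i) (convex hull (f (x i))))"
      unfolding \<Phi>_def
    proof (rule sum.cong[OF refl])
      fix i assume i: "i \<in> {1..n}"
      then have "map f xs ! (i - 1) = f (x i)" using xs_nth[OF i] len by (subst nth_map) auto
      then show "scale_set (c i) (convex hull (map f xs ! (i - 1)))
        = scale_set (c i) (convex hull (f (x i)))" by simp
    qed
    show "\<Phi> (map f xs) \<in> nonempty_convex_compacts"
      unfolding \<Phi>f by (intro nonempty_convex_compacts_combination fx)
    fix u
    have hull: "convex hull (f (x i)) \<in> nonempty_compacts" if "i \<in> {1..n}" for i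
      using fx[OF that] unfolding nonempty_compacts_def by (auto intro: compact_convex_hull)
    have "support (\<Phi> (map f xs)) u
      = (\<Sum>i\<in>{1..n}. support (scale_set (c i) (convex hull (f (x i)))) u)"
      unfolding \<Phi>f using hull by (intro support_sum nonempty_compacts_scale) auto
    also have "\<dots> = (\<Sum>i=1..n. c i * support (f (x i)) u)"
      using hull fx c0 by (intro sum.cong) (simp_all add: support_scale support_convex_hull)
    finally have s\<Phi>: "support (\<Phi> (map f xs)) u = (\<Sum>i=1..n. c i * support (f (x i)) u)" .
    have cont: "continuous_on {0..1} (\<lambda>t. P t * support (f t) u)"
      by (intro continuous_intros P_cont support_continuous f)
    have sI: "support (rm_integral (\<lambda>x. scale_set (P x) (f x))) u
        = (\<Sum>i=1..n. integral {a (i - 1)..a i} (\<lambda>t. P t * support (f t) u))"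
      unfolding rm_integral_weighted(2)[OF f]
      using integral_partition[of n a "\<lambda>t. P t * support (f t) u"] a integrable_continuous_interval[OF cont]
      by (simp add: less_imp_le)
    have "\<bar>integral {a (i - 1)..a i} (\<lambda>t. P t * support (f t) u) - c i * support (f (x i)) u\<bar>
        \<le> C i * Omega \<omega> (a i - a (i - 1)) * norm u" if i: "i \<in> {1..n}" for i
    proof -
      have int: "(\<lambda>t. P t * support (f t) u) integrable_on {a (i - 1)..a i}"
        using continuous_on_subset[OF cont T(6)[OF i]] by (rule integrable_continuous_interval)
      have int2: "(\<lambda>t. P t * support (f (x i)) u) integrable_on {a (i - 1)..a i}"
        using Pint[OF i] by (rule integrable_on_mult_left)
      have hi: "((\<lambda>t. C i * norm u * \<omega> \<bar>t - x i\<bar>) has_integral C i * norm u * Omega \<omega> (a i - a (i - 1))) {a (i - 1)..a i}"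
        using has_integral_modulus_midpoint[of "a (i - 1)" "a i"] a(3)[OF i] unfolding x_def
        by (intro has_integral_mult_right) simp
      have "integral {a (i - 1)..a i} (\<lambda>t. P t * support (f t) u) - c i * support (f (x i)) u
          = integral {a (i - 1)..a i} (\<lambda>t. P t * support (f t) u - P t * support (f (x i)) u)"
        using int int2 unfolding c_def by (subst integral_diff) auto
      also have "norm \<dots> \<le> integral {a (i - 1)..a i} (\<lambda>t. C i * norm u * \<omega> \<bar>t - x i\<bar>)"
      proof (rule integral_norm_bound_integral)
        show "(\<lambda>t. P t * support (f t) u - P t * support (f (x i)) u) integrable_on {a (i - 1)..a i}"
          using int int2 by (rule integrable_diff)
        show "(\<lambda>t. C i * norm u * \<omega> \<bar>t - x i\<bar>) integrable_on {a (i - 1)..a i}" using hi by blast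
        fix t assume t: "t \<in> {a (i - 1)..a i}"
        then have t01: "t \<in> {0..1}" using T(6)[OF i] by blast
        have "\<bar>support (f t) u - support (f (x i)) u\<bar> \<le> hausdorff_dist (f t) (f (x i)) * norm u"
          by (rule support_diff_le[OF H_classD(1)[OF f t01] fx[OF i]])
        also have "\<dots> \<le> \<omega> \<bar>t - x i\<bar> * norm u"
          using H_classD(2)[OF f t01 x01[OF i]] by (intro mult_right_mono) auto
        finally have "\<bar>support (f t) u - support (f (x i)) u\<bar> \<le> \<omega> \<bar>t - x i\<bar> * norm u" .
        then have "P t * \<bar>support (f t) u - support (f (x i)) u\<bar> \<le> C i * (\<omega> \<bar>t - x i\<bar> * norm u)"
          using C[OF i t] P_nonneg[OF t01] C0[OF i] by (intro mult_mono) auto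
        then show "norm (P t * support (f t) u - P t * support (f (x i)) u)
          \<le> C i * norm u * \<omega> \<bar>t - x i\<bar>"
          using P_nonneg[OF t01] by (simp add: right_diff_distrib[symmetric] abs_mult mult_ac)
      qed
      also have "\<dots> = C i * Omega \<omega> (a i - a (i - 1)) * norm u"
        unfolding integral_unique[OF hi] by (simp only: mult_ac)
      finally show ?thesis by simp
    qed
    then have "\<bar>support (rm_integral (\<lambda>x. scale_set (P x) (f x))) u - support (\<Phi> (map f xs)) u\<bar>
        \<le> (\<Sum>i=1..n. C i * Omega \<omega> (a i - a (i - 1)) * norm u)"
      unfolding sI s\<Phi> sum_subtractf[symmetric] by (intro order_trans[OF sum_abs sum_mono]) auto
    then show "\<bar>support (rm_integral (\<lambda>x. scale_set (P x) (f x))) u - support (\<Phi> (map f xs)) u\<bar>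
      \<le> E * norm u"
      unfolding E_def sum_distrib_right .
  qed
  then have "method_error P (H_class \<omega>) xs \<Phi> \<le> ereal E"
    unfolding method_error_def by (intro SUP_least) simp
  then show "knots_error P (H_class \<omega> :: (real \<Rightarrow> 'a set) set) xs
    \<le> ereal (\<Sum>i=1..n. C i * Omega \<omega> (a i - a (i - 1)))"
    unfolding knots_error_def E_def using \<Phi> by (meson INF_lower2)
qed

text \<open>The cells have equal integrals of \<open>\<rho> = l(P(t)) + \<epsilon>\<close>. The summand \<open>\<epsilon>\<close> keeps \<open>\<rho>\<close> away from
  zero, so that all cells become short even where \<open>P\<close> vanishes.\<close>

lemma optimal_error_upper:
  assumes \<epsilon>: "\<epsilon> > 0"
  shows "\<exists>n0. \<forall>n\<ge>n0. optimal_error P (H_class \<omega> :: (real \<Rightarrow> 'a::euclidean_space set) set) n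
    \<le> ereal (real n * Omega \<omega> ((1 + \<epsilon>) * (total_density + \<epsilon>) / real n))"
proof -
  define \<rho> where "\<rho> t = gamma_limit \<omega> (P t) + \<epsilon>" for t
  define G where "G x = integral {0..x} \<rho>" for x
  define T where "T = total_density + \<epsilon>"
  have \<rho>c: "continuous_on {0..1} \<rho>" unfolding \<rho>_def by (intro continuous_intros gamma_limit_P_cont)
  have \<rho>\<epsilon>: "\<epsilon> \<le> \<rho> t" if "t \<in> {0..1}" for t unfolding \<rho>_def using gamma_limit_nonneg P_nonneg that
    by simp
  have \<rho>i: "\<rho> integrable_on {x..y}" if "0 \<le> x" "y \<le> 1" for x y
    using that by (intro integrable_continuous_interval continuous_on_subset[OF \<rho>c]) auto
  have Gdiff: "G y - G x = integral {x..y} \<rho>" if "0 \<le> x" "x \<le> y" "y \<le> 1" for x y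
    unfolding G_def using Henstock_Kurzweil_Integration.integral_combine[OF that(1,2) \<rho>i[of 0 y]] that by simp
  have Glow: "\<epsilon> * (y - x) \<le> G y - G x" if "0 \<le> x" "x \<le> y" "y \<le> 1" for x y
  proof -
    have "\<epsilon> * (y - x) = integral {x..y} (\<lambda>t. \<epsilon>)" using that by simp
    also have "\<dots> \<le> integral {x..y} \<rho>" using that \<rho>\<epsilon> by (intro integral_le \<rho>i) auto
    finally show ?thesis using Gdiff[OF that] by simp
  qed
  have G0: "G 0 = 0" unfolding G_def by simp
  have G1: "G 1 = T" unfolding G_def T_def total_density_def \<rho>_def
    using integrable_continuous_interval[OF gamma_limit_P_cont] by (subst integral_add) auto
  have T: "T > 0" using Glow[of 0 1] G0 G1 \<epsilon> by simp
  have Gc: "continuous_on {0..1} G" unfolding G_def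
    by (rule indefinite_integral_continuous_1) (use \<rho>i in auto)
  obtain h where h: "h > 0" "\<And>x t. 0 < x \<Longrightarrow> x \<le> h \<Longrightarrow> t \<in> {0..1} \<Longrightarrow>
    \<bar>gamma_fun \<omega> (P t) x - gamma_limit \<omega> (P t) * x\<bar> \<le> \<epsilon> * x"
    using gamma_P_uniform[OF \<epsilon>] by blast
  have "\<epsilon>\<^sup>2 > 0" using \<epsilon> by simp
  then obtain \<eta> where \<eta>: "\<eta> > 0" "\<And>x y. x \<in> {0..1} \<Longrightarrow> y \<in> {0..1} \<Longrightarrow> \<bar>x - y\<bar> \<le> \<eta> \<Longrightarrow> \<bar>\<rho> x - \<rho> y\<bar> \<le> \<epsilon>\<^sup>2"
    using uniformly_continuous_unit_interval[OF \<rho>c] by blast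
  \<comment> \<open>A cell has length at most \<open>T/(n \<epsilon>)\<close>, because \<open>\<rho> \<ge> \<epsilon>\<close>.\<close>
  define n0 where "n0 = Suc (nat \<lceil>T / (\<epsilon> * min h \<eta>)\<rceil>)"
  show ?thesis
  proof (intro exI[of _ n0] allI impI)
    fix n assume n0: "n \<ge> n0"
    then have n: "n > 0" unfolding n0_def by simp
    have m: "\<epsilon> * min h \<eta> > 0" using \<epsilon> h \<eta> by simp
    have "T / (\<epsilon> * min h \<eta>) \<le> real n" using n0 unfolding n0_def by linarith
    then have fine: "T / real n \<le> \<epsilon> * min h \<eta>" using m n by (simp add: field_simps)
    have "\<exists>x. 0 \<le> x \<and> x \<le> 1 \<and> G x = real i * T / real n" if "i \<le> n" for i
    proof (rule IVT'[OF _ _ _ Gc])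
      show "G 0 \<le> real i * T / real n" using G0 T by simp
      have "real i * T \<le> real n * T" using that T by (intro mult_right_mono) auto
      then show "real i * T / real n \<le> G 1" using G1 n by (simp add: divide_le_eq mult.commute)
    qed simp
    then obtain a where a: "\<And>i. i \<le> n \<Longrightarrow> 0 \<le> a i \<and> a i \<le> 1 \<and> G (a i) = real i * T / real n" by metis
    have le: "y \<le> x" if "x \<in> {0..1}" "y \<in> {0..1}" "G y \<le> G x" for x y
    proof (rule ccontr)
      assume "\<not> y \<le> x"
      then have "0 < \<epsilon> * (y - x)" using \<epsilon> by simp
      also have "\<dots> \<le> G y - G x" using \<open>\<not> y \<le> x\<close> that by (intro Glow) auto
      finally show False using that by simp
    qed
    have inj: "x = y" if "x \<in> {0..1}" "y \<in> {0..1}" "G x = G y" for x y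
      using le[of x y] le[of y x] that by simp
    have a0: "a 0 = 0" by (rule inj) (use a[of 0] G0 in auto)
    have an: "a n = 1" by (rule inj) (use a[of n] G1 n in auto)
    have cell: "G (a i) - G (a (i - 1)) = T / real n" if i: "i \<in> {1..n}" for i
    proof -
      obtain k where k: "i = Suc k" "k < n" using i by (cases i) auto
      show ?thesis using a[of i] a[of k] k n
        by (simp add: diff_divide_distrib[symmetric] left_diff_distrib[symmetric])
    qed
    have lt: "a (i - 1) < a i" if i: "i \<in> {1..n}" for i
    proof -
      have pos: "0 < T / real n" using T n by simp
      have "a (i - 1) \<le> a i"
        by (rule le) (use a[of i] a[of "i - 1"] i cell[OF i] pos in auto)
      moreover have "a (i - 1) \<noteq> a i" using cell[OF i] pos by auto
      ultimately show ?thesis by simp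
    qed
    have sub: "{a (i - 1)..a i} \<subseteq> {0..1}" if i: "i \<in> {1..n}" for i
      using a[of i] a[of "i - 1"] i by auto
    have "\<exists>\<xi>\<in>{a (i - 1)..a i}. \<forall>t\<in>{a (i - 1)..a i}. P t \<le> P \<xi>" if i: "i \<in> {1..n}" for i
      using continuous_attains_sup[of "{a (i - 1)..a i}" P] continuous_on_subset[OF P_cont sub[OF i]] lt[OF i]
      by auto
    then obtain \<xi> where \<xi>: "\<And>i. i \<in> {1..n} \<Longrightarrow> \<xi> i \<in> {a (i - 1)..a i}"
      "\<And>i t. i \<in> {1..n} \<Longrightarrow> t \<in> {a (i - 1)..a i} \<Longrightarrow> P t \<le> P (\<xi> i)" by metis
    define xs where "xs = map (\<lambda>i. (a i + a (Suc i)) / 2) [0..<n]"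
    have bound: "P (\<xi> i) * Omega \<omega> (a i - a (i - 1)) \<le> Omega \<omega> ((1 + \<epsilon>) * T / real n)"
      if i: "i \<in> {1..n}" for i
    proof -
      define d where "d = a i - a (i - 1)"
      have d0: "0 < d" using lt[OF i] unfolding d_def by simp
      have ai: "0 \<le> a (i - 1)" "a (i - 1) \<le> a i" "a i \<le> 1" using sub[OF i] lt[OF i] by auto
      have \<xi>01: "\<xi> i \<in> {0..1}" using \<xi>(1)[OF i] sub[OF i] by blast
      have \<epsilon>d: "\<epsilon> * d \<le> T / real n" using Glow[OF ai] cell[OF i] unfolding d_def by simp
      then have "\<epsilon> * d \<le> \<epsilon> * min h \<eta>" using fine by simp
      then have dh: "d \<le> h" "d \<le> \<eta>" using \<epsilon> by auto
      have p: "0 \<le> P (\<xi> i)" using P_nonneg[OF \<xi>01] .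
      have "gamma_fun \<omega> (P (\<xi> i)) d \<le> \<rho> (\<xi> i) * d"
        using h(2)[OF d0 dh(1) \<xi>01] unfolding \<rho>_def by (simp add: abs_le_iff algebra_simps)
      also have "\<rho> (\<xi> i) * d = integral {a (i - 1)..a i} (\<lambda>t. \<rho> (\<xi> i))" using ai unfolding d_def
        by simp
      also have "\<dots> \<le> integral {a (i - 1)..a i} (\<lambda>t. \<rho> t + \<epsilon>\<^sup>2)"
      proof (rule integral_le)
        show "(\<lambda>t. \<rho> t + \<epsilon>\<^sup>2) integrable_on {a (i - 1)..a i}"
          using \<rho>i[OF ai(1,3)] by (intro integrable_add) auto
        fix t assume t: "t \<in> {a (i - 1)..a i}"
        then have "\<bar>\<xi> i - t\<bar> \<le> \<eta>" using \<xi>(1)[OF i] dh(2) unfolding d_def by auto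
        then show "\<rho> (\<xi> i) \<le> \<rho> t + \<epsilon>\<^sup>2" using \<eta>(2)[of "\<xi> i" t] \<xi>01 t sub[OF i]
          by (auto simp: abs_le_iff)
      qed (rule integrable_const_ivl)
      also have "\<dots> = T / real n + \<epsilon> * (\<epsilon> * d)"
        using \<rho>i[OF ai(1,3)] Gdiff[OF ai] cell[OF i] ai
        by (subst integral_add) (auto simp: d_def power2_eq_square)
      also have "\<dots> \<le> T / real n + \<epsilon> * (T / real n)" using \<epsilon>d \<epsilon>
        by (intro add_left_mono mult_left_mono) auto
      also have "\<dots> = (1 + \<epsilon>) * T / real n" by (simp add: algebra_simps add_divide_distrib)
      finally have "gamma_fun \<omega> (P (\<xi> i)) d \<le> (1 + \<epsilon>) * T / real n" .
      then have "Omega \<omega> (gamma_fun \<omega> (P (\<xi> i)) d) \<le> Omega \<omega> ((1 + \<epsilon>) * T / real n)"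
        using gamma_fun(1)[OF p, of d] d0 by (intro Omega_mono) auto
      then show ?thesis using gamma_fun(2)[OF p, of d] d0 unfolding d_def by simp
    qed
    have "optimal_error P (H_class \<omega> :: (real \<Rightarrow> 'a set) set) n
      \<le> knots_error P (H_class \<omega> :: (real \<Rightarrow> 'a set) set) xs"
      unfolding optimal_error_def xs_def
      by (intro INF_lower knots_error_le(1)[OF a0 an lt \<xi>(2)]) auto
    also have "\<dots> \<le> ereal (\<Sum>i=1..n. P (\<xi> i) * Omega \<omega> (a i - a (i - 1)))"
      unfolding xs_def by (intro knots_error_le(2)[OF a0 an lt \<xi>(2)]) auto
    also have "\<dots> \<le> ereal (\<Sum>i=1..n. Omega \<omega> ((1 + \<epsilon>) * T / real n))"
      unfolding ereal_less_eq(3) by (intro sum_mono bound)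
    finally show "optimal_error P (H_class \<omega> :: (real \<Rightarrow> 'a set) set) n
      \<le> ereal (real n * Omega \<omega> ((1 + \<epsilon>) * (total_density + \<epsilon>) / real n))"
      unfolding T_def by simp
  qed
qed

lemma optimal_error_lower:
  assumes "\<epsilon> > 0" "2 * \<epsilon> \<le> total_density"
  shows "\<exists>K. \<forall>n>0. ereal (real (n + K) * Omega \<omega> ((total_density - 2 * \<epsilon>) / real (n + K)))
    \<le> optimal_error P (H_class \<omega> :: (real \<Rightarrow> 'a::euclidean_space set) set) n"
proof -
  obtain K where K: "\<And>n xs. n > 0 \<Longrightarrow> xs \<in> knot_lists n \<Longrightarrow>
    real (n + K) * Omega \<omega> ((total_density - 2 * \<epsilon>) / real (n + K))
      \<le> integral {0..1} (\<lambda>t. P t * \<omega> (infdist t (set xs)))"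
    using weighted_distance_integral_ge[OF assms] by blast
  show ?thesis
  proof (intro exI[of _ K] allI impI)
    fix n :: nat assume n: "n > 0"
    show "ereal (real (n + K) * Omega \<omega> ((total_density - 2 * \<epsilon>) / real (n + K)))
      \<le> optimal_error P (H_class \<omega> :: (real \<Rightarrow> 'a set) set) n"
      unfolding optimal_error_def
    proof (rule INF_greatest)
      fix xs assume xs: "xs \<in> knot_lists n"
      have "ereal (real (n + K) * Omega \<omega> ((total_density - 2 * \<epsilon>) / real (n + K)))
          \<le> ereal (integral {0..1} (\<lambda>t. P t * \<omega> (infdist t (set xs))))"
        using K[OF n xs] by simp
      also have "\<dots> \<le> knots_error P (H_class \<omega> :: (real \<Rightarrow> 'a set) set) xs"
        by (rule knots_error_ge) (use xs n in \<open>auto simp: knot_lists_def\<close>)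
      finally show "ereal (real (n + K) * Omega \<omega> ((total_density - 2 * \<epsilon>) / real (n + K)))
          \<le> knots_error P (H_class \<omega> :: (real \<Rightarrow> 'a set) set) xs" .
    qed
  qed
qed

lemma optimal_error_asymptotic:
  assumes B: "total_density > 0" (is "?B > 0")
  shows "(\<lambda>n. optimal_error P (H_class \<omega> :: (real \<Rightarrow> 'a::euclidean_space set) set) n
    / ereal (real n * Omega \<omega> (total_density / real n))) \<longlonglongrightarrow> 1"
proof -
  let ?R = "\<lambda>n. optimal_error P (H_class \<omega> :: (real \<Rightarrow> 'a set) set) n"
  let ?D = "\<lambda>n. real n * Omega \<omega> (?B / real n)"
  have D: "?D n > 0" if "n > 0" for n using that B by (intro mult_pos_pos Omega_pos) auto
  have lower: "\<forall>\<^sub>F n in sequentially. ereal (1 - \<delta>) \<le> ?R n / ereal (?D n)" if \<delta>: "0 < \<delta>" "\<delta> \<le> 1"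
    for \<delta>
  proof -
    \<comment> \<open>Passing from \<open>B - 2\<epsilon>\<close> to \<open>B\<close> and from \<open>n + K\<close> to \<open>n\<close> each costs a factor \<open>1 - \<delta>/8\<close>
      in the argument of \<open>\<Omega>\<close>; \<open>Omega_near_one\<close> turns the resulting \<open>1 - \<delta>/4\<close> into \<open>1 - \<delta>\<close>.\<close>
    define \<epsilon> where "\<epsilon> = \<delta> * ?B / 16"
    have \<epsilon>: "\<epsilon> > 0" "2 * \<epsilon> \<le> ?B" "?B - 2 * \<epsilon> = (1 - \<delta> / 8) * ?B"
      unfolding \<epsilon>_def using \<delta> B mult_right_mono[of \<delta> 1 ?B] by (auto simp: algebra_simps)
    obtain K where K: "\<And>n. n > 0 \<Longrightarrow> ereal (real (n + K) * Omega \<omega> ((?B - 2 * \<epsilon>) / real (n + K)))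
      \<le> ?R n"
      using optimal_error_lower[OF \<epsilon>(1,2)] by blast
    show ?thesis
    proof (rule eventually_mono[OF eventually_ge_at_top[of "Suc (nat \<lceil>8 * real K / \<delta>\<rceil>)"]])
      fix n assume n: "Suc (nat \<lceil>8 * real K / \<delta>\<rceil>) \<le> n"
      then have n0: "n > 0" by simp
      have "8 * real K / \<delta> \<le> real n" using n by linarith
      then have "8 * real K \<le> \<delta> * real n" using \<delta> by (simp add: field_simps)
      define q where "q = real n / real (n + K)"
      have "1 - \<delta> / 8 \<le> q"
      proof -
        have "(1 - \<delta> / 8) * (real n + real K) \<le> real n"
          using \<open>8 * real K \<le> \<delta> * real n\<close> \<delta>
            by (simp add: algebra_simps) (smt (verit) mult_nonneg_nonneg of_nat_0_le_iff)
        then show ?thesis unfolding q_def using n0 by (simp add: le_divide_eq)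
      qed
      moreover have "q \<le> 1" unfolding q_def using n0 by simp
      ultimately have q: "1 - \<delta> / 8 \<le> q" "q \<le> 1" by auto
      define l where "l = (1 - \<delta> / 8) * q"
      have "(1 - \<delta> / 8) * (1 - \<delta> / 8) \<le> l" unfolding l_def using q \<delta> by (intro mult_left_mono) auto
      moreover have "1 - \<delta> / 4 \<le> (1 - \<delta> / 8) * (1 - \<delta> / 8)" by (simp add: algebra_simps)
      ultimately have l: "1 - \<delta> / 4 \<le> l" by simp
      have l1: "l \<le> 1" unfolding l_def using q \<delta> by (intro mult_le_one) auto
      have eq: "(?B - 2 * \<epsilon>) / real (n + K) = l * (?B / real n)"
        unfolding l_def q_def \<epsilon>(3) using n0 by simp
      have O: "0 \<le> Omega \<omega> (?B / real n)" using B by (intro Omega_nonneg) simp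
      have "(1 - \<delta>) * Omega \<omega> (?B / real n) \<le> (1 - 4 * (1 - l)) * Omega \<omega> (?B / real n)"
        using l O by (intro mult_right_mono) auto
      also have "\<dots> \<le> Omega \<omega> (l * (?B / real n))" using l l1 \<delta> B by (intro Omega_near_one) auto
      finally have main: "(1 - \<delta>) * Omega \<omega> (?B / real n) \<le> Omega \<omega> (l * (?B / real n))" .
      have "(1 - \<delta>) * ?D n = real n * ((1 - \<delta>) * Omega \<omega> (?B / real n))" by simp
      also have "\<dots> \<le> real n * Omega \<omega> (l * (?B / real n))" by (intro mult_left_mono main) simp
      also have "\<dots> \<le> real (n + K) * Omega \<omega> (l * (?B / real n))"
        using l \<delta> B by (intro mult_right_mono Omega_nonneg) auto
      finally have "ereal ((1 - \<delta>) * ?D n) \<le> ?R n"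
        using K[OF n0] unfolding eq by (meson ereal_less_eq(3) order_trans)
      then show "ereal (1 - \<delta>) \<le> ?R n / ereal (?D n)"
        using D[OF n0] by (subst ereal_le_divide_pos) (auto simp: mult.commute)
    qed
  qed
  have upper: "\<forall>\<^sub>F n in sequentially. ?R n / ereal (?D n) \<le> ereal (1 + \<delta>)" if \<delta>: "0 < \<delta>" for \<delta>
  proof -
    have "((\<lambda>\<epsilon>. (1 + \<delta>) * (1 - 4 * (1 - ?B / ((1 + \<epsilon>) * (?B + \<epsilon>))))) \<longlongrightarrow>
        (1 + \<delta>) * (1 - 4 * (1 - ?B / ((1 + 0) * (?B + 0))))) (at_right 0)"
      using B by (intro tendsto_intros) auto
    then have "((\<lambda>\<epsilon>. (1 + \<delta>) * (1 - 4 * (1 - ?B / ((1 + \<epsilon>) * (?B + \<epsilon>))))) \<longlongrightarrow> 1 + \<delta>) (at_right 0)"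
      using B by simp
    from order_tendstoD(1)[OF this, of 1] \<delta>
    obtain b where "b > 0" "\<And>\<epsilon>. 0 < \<epsilon> \<Longrightarrow> \<epsilon> < b
      \<Longrightarrow> 1 < (1 + \<delta>) * (1 - 4 * (1 - ?B / ((1 + \<epsilon>) * (?B + \<epsilon>))))"
      unfolding eventually_at_right_field by auto
    from this(1) this(2)[of "b / 2"] obtain \<epsilon> where \<epsilon>: "\<epsilon> > 0" "1 < (1 + \<delta>) * (1 - 4 * (1 - ?B / ((1 + \<epsilon>) * (?B + \<epsilon>))))"
      by (metis field_sum_of_halves half_gt_zero less_add_same_cancel1)
    define \<mu> where "\<mu> = (1 + \<epsilon>) * (?B + \<epsilon>) / ?B"
    have \<mu>: "\<mu> \<ge> 1" "1 < (1 + \<delta>) * (1 - 4 * (1 - 1 / \<mu>))"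
      unfolding \<mu>_def using \<epsilon> B by (auto simp: field_simps)
    obtain n0 where n0: "\<And>n. n \<ge> n0 \<Longrightarrow> ?R n \<le> ereal (real n * Omega \<omega> ((1 + \<epsilon>) * (?B + \<epsilon>) / real n))"
      using optimal_error_upper[OF \<epsilon>(1), where 'a='a] by blast
    show ?thesis
    proof (rule eventually_mono[OF eventually_ge_at_top[of "max 1 n0"]])
      fix n assume "max 1 n0 \<le> n"
      then have n: "n > 0" "n \<ge> n0" by auto
      let ?x = "\<mu> * (?B / real n)"
      have x: "(1 + \<epsilon>) * (?B + \<epsilon>) / real n = ?x" unfolding \<mu>_def using B by simp
      have x0: "0 \<le> ?x" using \<mu> B by simp
      have "(1 - 4 * (1 - 1 / \<mu>)) * Omega \<omega> ?x \<le> Omega \<omega> (1 / \<mu> * ?x)"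
        using \<mu>(1) x0 by (intro Omega_near_one) auto
      also have "1 / \<mu> * ?x = ?B / real n" using \<mu>(1) by simp
      finally have le: "(1 - 4 * (1 - 1 / \<mu>)) * Omega \<omega> ?x \<le> Omega \<omega> (?B / real n)" .
      have "1 * Omega \<omega> ?x \<le> ((1 + \<delta>) * (1 - 4 * (1 - 1 / \<mu>))) * Omega \<omega> ?x"
        using \<mu>(2) Omega_nonneg[OF x0] by (intro mult_right_mono) auto
      also have "\<dots> \<le> (1 + \<delta>) * Omega \<omega> (?B / real n)"
        using le \<delta> by (simp only: mult.assoc) (intro mult_left_mono, auto)
      finally have "real n * Omega \<omega> ?x \<le> real n * ((1 + \<delta>) * Omega \<omega> (?B / real n))"
        by (intro mult_left_mono) auto
      also have "\<dots> = (1 + \<delta>) * ?D n" by simp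
      finally have "?R n \<le> ereal ((1 + \<delta>) * ?D n)"
        using n0[OF n(2)] unfolding x by (meson ereal_less_eq(3) order_trans)
      then show "?R n / ereal (?D n) \<le> ereal (1 + \<delta>)"
        using D[OF n(1)] by (subst ereal_divide_le_pos) (auto simp: mult.commute)
    qed
  qed
  show ?thesis
  proof (rule order_tendstoI)
    fix a :: ereal assume a: "a < 1"
    obtain r where r: "a < ereal r" "ereal r < 1" using ereal_dense2[OF a] by blast
    define \<delta> where "\<delta> = min 1 (1 - r)"
    have "0 < \<delta>" "\<delta> \<le> 1" "r \<le> 1 - \<delta>" using r(2) unfolding \<delta>_def by auto
    then have "a < ereal (1 - \<delta>)" using r(1) by (metis ereal_less_eq(3) less_le_trans)
    then show "\<forall>\<^sub>F n in sequentially. a < ?R n / ereal (?D n)"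
      using lower[OF \<open>0 < \<delta>\<close> \<open>\<delta> \<le> 1\<close>] by (auto elim!: eventually_mono intro: less_le_trans)
  next
    fix a :: ereal assume a: "1 < a"
    obtain r where r: "1 < ereal r" "ereal r < a" using ereal_dense2[OF a] by blast
    have "0 < r - 1" using r(1) by simp
    from upper[OF this] show "\<forall>\<^sub>F n in sequentially. ?R n / ereal (?D n) < a"
      using r(2) by (auto elim!: eventually_mono intro: le_less_trans)
  qed
qed

end

lemma AE_positive_dense:
  fixes P :: "real \<Rightarrow> real"
  assumes "AE x in lebesgue_on {0..1}. P x > 0" "0 \<le> a" "a < b" "b \<le> 1"
  shows "\<exists>x\<in>{a..b}. P x > 0"
proof (rule ccontr)
  assume *: "\<not> ?thesis"
  have "AE x in lebesgue. x \<in> {0..1} \<longrightarrow> P x > 0"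
    using assms(1) by (simp add: AE_restrict_space_iff)
  then have "AE x in lebesgue. x \<notin> {a..b}"
    by (rule eventually_mono) (use * assms in force)
  then have "{a..b} \<in> null_sets lebesgue" by (subst AE_iff_null_sets) auto
  then have "emeasure lebesgue {a..b} = 0" by auto
  then show False using assms(3) by simp
qed

theorem theorem3:
  fixes \<omega> P :: "real \<Rightarrow> real" and B :: real
  assumes "modulus_of_continuity \<omega>"
    and "\<exists>t\<ge>0. \<omega> t \<noteq> 0"
    and "\<And>c. c > 0 \<Longrightarrow> \<exists>\<epsilon>>0. mono_on {0<..<\<epsilon>} (\<lambda>x. gamma_fun \<omega> c x / x) \<or>
                             antimono_on {0<..<\<epsilon>} (\<lambda>x. gamma_fun \<omega> c x / x)"
    and "continuous_on {0..1} P"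
    and "AE x in lebesgue_on {0..1}. P x > 0"
    and "B = lim (B_seq P \<omega>)"
  shows "convergent (B_seq P \<omega>) \<and>
    limsup (\<lambda>n. optimal_error P (H_class \<omega> :: (real \<Rightarrow> (real ^ 'm) set) set) n /
                 ereal (real n * Omega \<omega> (B / real n))) = 1"
proof -
  \<comment> \<open>Positivity almost everywhere gives positivity on a dense set only; continuity does the rest.\<close>
  have nonneg: "0 \<le> P t" if t: "t \<in> {0..1}" for t
  proof (rule ccontr)
    assume "\<not> 0 \<le> P t"
    then obtain d where d: "d > 0" "\<And>s. s \<in> {0..1} \<Longrightarrow> dist s t < d \<Longrightarrow> dist (P s) (P t) < - P t"
      using assms(4) t unfolding continuous_on_iff by (metis neg_0_less_iff_less not_le)
    define a b where "a = max 0 (t - d / 2)" and "b = min 1 (t + d / 2)"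
    have ab: "0 \<le> a" "a < b" "b \<le> 1" using t d(1) unfolding a_def b_def by auto
    obtain s where s: "s \<in> {a..b}" "P s > 0" using AE_positive_dense[OF assms(5) ab] by blast
    have "dist (P s) (P t) < - P t"
      using s(1) ab d(1) by (intro d(2)) (auto simp: a_def b_def dist_real_def)
    then show False using s(2) by (simp add: dist_real_def)
  qed
  interpret weighted_modulus \<omega> P
    by unfold_locales (use assms(1-4) nonneg in blast)+
  have lim: "B_seq P \<omega> \<longlonglongrightarrow> total_density" by (rule B_seq_tendsto)
  then have B: "B = total_density" using assms(6) limI by blast
  have "total_density > 0" using AE_positive_dense[OF assms(5), of 0 1]
    by (intro total_density_pos) auto
  then show ?thesis
    using lim optimal_error_asymptotic[where 'a = "real ^ 'm"] unfolding B
    by (auto simp: convergent_def intro!: lim_imp_Limsup)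
qed

end
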